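(* Let $\xi=(\xi_s)_{s\ge0}$ be a one-dimensional Lévy process with $\lim_{s\to\infty}\xi_s=\infty$ almost surely. For a Borel measurable function $f:\mathbb{R}\to[0,\infty)$, say that the integral test holds for $f$ if for every $x\in\mathbb{R}$: $\mathbb{P}\left(\int_0^\infty f(x+\xi_s)\,ds<\infty\right)=0$ if and only if $\int_E f(x+y)\,U(dy)=\infty$ for every Borel set $E\subseteq\mathbb{R}$ such that $\mathbb{R}\setminus E$ is $\mathbb{P}^x$-transient; and otherwise, i.e. if $\int_E f(x+y)\,U(dy)<\infty$ for some such $E$, then $\int_0^\infty f(x+\xi_s)\,ds<\infty$ almost surely. (i) Let $f:\mathbb{R}\to[0,\infty)$ be Borel measurable and locally bounded. Suppose there are a Borel set $L\subseteq\mathbb{R}$ and a non-decreasing sequence of functions $(f_n)_{n\ge1}$ of the form $$f_n=\sum_{j=1}^{k(n)}c_j^{(n)}\,\mathbb{I}_{(\alpha_j^{(n)},\beta_j^{(n)})},\qquad \alpha^{(n)}_j<\beta^{(n)}_j\ \text{real},\quad c^{(n)}_j\ge 0,$$ such that $f=\lim_{n\to\infty}f_n$ pointwise on $L$, and such that $\mathbb{P}(x+\xi_s\in L^c)=0$ for all $s>0$ and $x\in\mathbb{R}$. Then the integral test holds for $f$. (ii) In particular, if $\mathbb{P}(x+\xi_s\in A)=0$ for all $s>0$, all $x\in\mathbb{R}$ and every set $A$ of zero Lebesgue measure, then the integral test holds for every non-negative, locally bounded, Borel measurable function $f$. (iii) The claims in (i) and (ii) are also true for non-negative, locally integrable (instead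 of locally bounded) functions $f$, provided that almost surely $\int_0^t f(x+\xi_s)\,ds<\infty$ for all $t>0$, for every $x\in\mathbb{R}$.
   Context: A Lévy process is an almost surely right-continuous (with left limits) real-valued process with stationary independent increments, started at $\xi_0=0$ under $\mathbb{P}$. For $x\in\mathbb{R}$, $\mathbb{P}^x$ denotes the law of $x+\xi$. The potential measure of $\xi$ is $U(dy)=\int_0^\infty \mathbb{P}(\xi_s\in dy)\,ds$, which is finite on compact sets since $\xi$ is transient. For a Borel set $E\subseteq\mathbb{R}$, the set $\mathbb{R}\setminus E$ is called $\mathbb{P}^x$-transient if $\mathbb{P}^x(\exists\,\tau\ge 0:\ \xi_s\in E\ \ \forall s\ge\tau)=1$, i.e. $\mathbb{P}(\exists\,\tau\ge 0:\ x+\xi_s\in E\ \ \forall s\ge\tau)=1$. $\mathbb{I}_B$ denotes the indicator function of $B$, $L^c=\mathbb{R}\setminus L$, and locally integrable means integrable over compact sets with respect to Lebesgue measure.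
   Formalization: The integral of f(x+y) against U is taken over those y with x+y in E, not over y in E; as printed the test fails, e.g. for a Poisson process with f=1, x=1/2, E=Z+1/2, where U(E)=0 although x+ξ never leaves E. *)

theory Defs
  imports "HOL-Probability.Probability"
begin

text \<open>
  Sample paths are only almost surely regular and the underlying probability space need not be
  complete, so events involving whole paths (finiteness of a perpetual integral, eventual
  membership in a Borel set) need not be measurable, and \<open>measure M\<close> would assign the junk value
  0 to them. Therefore \<open>P(H) = 1\<close> and \<open>P(H) = 0\<close> are written \<open>AE \<omega> in M. H \<omega>\<close> and
  \<open>AE \<omega> in M. \<not> H \<omega>\<close>, i.e. with respect to the completion of the probability measure.
\<close>

locale levy_process = prob_space M for M :: "'a measure" +
  fixes \<xi> :: "real \<Rightarrow> 'a \<Rightarrow> real"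
  assumes random_variable: "0 \<le> s \<Longrightarrow> \<xi> s \<in> borel_measurable M"
    and start: "AE \<omega> in M. \<xi> 0 \<omega> = 0"
    and independent_increments:
      "0 \<le> t 0 \<Longrightarrow> (\<And>i. i < n \<Longrightarrow> t i \<le> t (Suc i)) \<Longrightarrow>
        indep_vars (\<lambda>_. borel) (\<lambda>i \<omega>. \<xi> (t (Suc i)) \<omega> - \<xi> (t i) \<omega>) {..<n::nat}"
    and stationary_increments:
      "0 \<le> s \<Longrightarrow> 0 \<le> h \<Longrightarrow>
        distr M borel (\<lambda>\<omega>. \<xi> (s + h) \<omega> - \<xi> s \<omega>) = distr M borel (\<lambda>\<omega>. \<xi> h \<omega> - \<xi> 0 \<omega>)"
    and cadlag:
      "AE \<omega> in M. (\<forall>s\<ge>0. ((\<lambda>r. \<xi> r \<omega>) \<longlongrightarrow> \<xi> s \<omega>) (at_right s)) \<and>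
                  (\<forall>s>0. \<exists>l. ((\<lambda>r. \<xi> r \<omega>) \<longlongrightarrow> l) (at_left s))"

definition potential_measure :: "'a measure \<Rightarrow> (real \<Rightarrow> 'a \<Rightarrow> real) \<Rightarrow> real measure" where
  "potential_measure M \<xi> = measure_of UNIV (sets borel)
     (\<lambda>B. \<integral>\<^sup>+ s\<in>{0..}. emeasure M {\<omega> \<in> space M. \<xi> s \<omega> \<in> B} \<partial>lborel)"

definition transient_from ::
  "'a measure \<Rightarrow> (real \<Rightarrow> 'a \<Rightarrow> real) \<Rightarrow> real \<Rightarrow> real set \<Rightarrow> bool" where
  "transient_from M \<xi> x D \<longleftrightarrow> (AE \<omega> in M. \<exists>\<tau>\<ge>0. \<forall>s\<ge>\<tau>. x + \<xi> s \<omega> \<in> - D)"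

definition perpetual_integral ::
  "(real \<Rightarrow> 'a \<Rightarrow> real) \<Rightarrow> (real \<Rightarrow> real) \<Rightarrow> real \<Rightarrow> 'a \<Rightarrow> ennreal" where
  "perpetual_integral \<xi> f x \<omega> = (\<integral>\<^sup>+ s\<in>{0..}. ennreal (f (x + \<xi> s \<omega>)) \<partial>lborel)"

text \<open>
  Under the law of \<open>x + \<xi>\<close>, the set \<open>E\<close> is a set of positions of the shifted process \<open>x + \<xi>\<close>,
  whereas \<open>U\<close> is the potential measure of the unshifted process. The integral of \<open>f\<close> over \<open>E\<close>
  against the potential measure of \<open>x + \<xi>\<close>, often abbreviated to the integral over \<open>E\<close> of
  \<open>f (x + y)\<close> against \<open>U\<close>, is therefore taken over those \<open>y\<close> with \<open>x + y \<in> E\<close>. Taking it over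
  \<open>y \<in> E\<close> would be wrong on lattices: for a Poisson process, \<open>x = 1/2\<close>, \<open>f = 1\<close> and
  \<open>E = \<int> + 1/2\<close>, the path \<open>x + \<xi>\<close> never leaves \<open>E\<close>, but \<open>U E = 0\<close>.
\<close>

definition potential_integral ::
  "'a measure \<Rightarrow> (real \<Rightarrow> 'a \<Rightarrow> real) \<Rightarrow> (real \<Rightarrow> real) \<Rightarrow> real \<Rightarrow> real set \<Rightarrow> ennreal" where
  "potential_integral M \<xi> f x E =
     (\<integral>\<^sup>+ y\<in>{y. x + y \<in> E}. ennreal (f (x + y)) \<partial>potential_measure M \<xi>)"

definition integral_test ::
  "'a measure \<Rightarrow> (real \<Rightarrow> 'a \<Rightarrow> real) \<Rightarrow> (real \<Rightarrow> real) \<Rightarrow> bool" where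
  "integral_test M \<xi> f \<longleftrightarrow> (\<forall>x.
     ((AE \<omega> in M. \<not> perpetual_integral \<xi> f x \<omega> < \<infinity>) \<longleftrightarrow>
        (\<forall>E\<in>sets borel. transient_from M \<xi> x (UNIV - E) \<longrightarrow> potential_integral M \<xi> f x E = \<infinity>)) \<and>
     ((\<exists>E\<in>sets borel. transient_from M \<xi> x (UNIV - E) \<and> potential_integral M \<xi> f x E < \<infinity>) \<longrightarrow>
        (AE \<omega> in M. perpetual_integral \<xi> f x \<omega> < \<infinity>)))"

definition locally_bounded :: "(real \<Rightarrow> real) \<Rightarrow> bool" where
  "locally_bounded f \<longleftrightarrow> (\<forall>K. compact K \<longrightarrow> bounded (f ` K))"

definition locally_integrable :: "(real \<Rightarrow> real) \<Rightarrow> bool" where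
  "locally_integrable f \<longleftrightarrow> (\<forall>K. compact K \<longrightarrow> set_integrable lborel K f)"

definition open_step_function :: "(real \<Rightarrow> real) \<Rightarrow> bool" where
  "open_step_function g \<longleftrightarrow> (\<exists>(k::nat) c \<alpha> \<beta>.
     (\<forall>j\<in>{1..k}. \<alpha> j < \<beta> j \<and> 0 \<le> c j) \<and>
     g = (\<lambda>y. \<Sum>j=1..k. c j * indicator {\<alpha> j<..<\<beta> j} y))"

definition increasing_step_limit_on :: "real set \<Rightarrow> (real \<Rightarrow> real) \<Rightarrow> bool" where
  "increasing_step_limit_on L f \<longleftrightarrow> (\<exists>F :: nat \<Rightarrow> real \<Rightarrow> real.
     (\<forall>n\<ge>1. open_step_function (F n)) \<and>
     (\<forall>n\<ge>1. \<forall>y. F n y \<le> F (Suc n) y) \<and>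
     (\<forall>y\<in>L. (\<lambda>n. F n y) \<longlonglongrightarrow> f y))"

context levy_process
begin

lemma measurable_marginal_open:
  assumes "open B"
  shows "(\<lambda>s. indicator {0..} s * measure M {\<omega> \<in> space M. \<xi> s \<omega> \<in> B}) \<in> borel_measurable lborel"
proof -
  define g :: "nat \<Rightarrow> real \<Rightarrow> real" where
    "g n y = (if B = UNIV then 1 else min 1 (real n * infdist y (- B)))" for n y
  have g_cont: "continuous_on UNIV (g n)" for n
    unfolding g_def by (cases "B = UNIV") (auto intro!: continuous_intros)
  have g_bd: "\<bar>g n y\<bar> \<le> 1" for n y
    by (auto simp: g_def infdist_nonneg)
  have [measurable]: "g n \<in> borel_measurable borel" for n
    using g_cont by (rule borel_measurable_continuous_onI)
  have Bm[measurable]: "B \<in> sets borel" using assms by simp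
  have g_lim: "(\<lambda>n. g n y) \<longlonglongrightarrow> indicator B y" for y
  proof (cases "B = UNIV \<or> y \<notin> B")
    case True
    then show ?thesis
    proof
      assume "B = UNIV" then show ?thesis by (simp add: g_def)
    next
      assume "y \<notin> B"
      then have "g n y = indicator B y" for n by (auto simp: g_def)
      then show ?thesis by simp
    qed
  next
    case False
    then have "infdist y (- B) > 0"
      using assms infdist_pos_not_in_closed[of "- B" y] by auto
    then have "eventually (\<lambda>n. real n * infdist y (- B) \<ge> 1) sequentially"
      by real_asymp
    then have "eventually (\<lambda>n. g n y = indicator B y) sequentially"
      by eventually_elim (use False in \<open>auto simp: g_def\<close>)
    then show ?thesis by (rule tendsto_eventually)
  qed
  define r :: "nat \<Rightarrow> real \<Rightarrow> real" where "r m s = (of_int \<lfloor>real (Suc m) * s\<rfloor> + 1) / real (Suc m)" for m s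
  have r_gt: "r m s > s" for m s
    unfolding r_def by (simp add: field_simps) linarith
  have r_le: "r m s \<le> s + 1 / real (Suc m)" for m s
  proof -
    have "(of_int \<lfloor>real (Suc m) * s\<rfloor> + 1) / real (Suc m) \<le> (real (Suc m) * s + 1) / real (Suc m)"
      by (intro divide_right_mono add_right_mono of_int_floor_le) simp
    also have "\<dots> = s + 1 / real (Suc m)" by (simp add: add_divide_distrib)
    finally show ?thesis unfolding r_def .
  qed
  have r_lim: "filterlim (\<lambda>m. r m s) (at_right s) sequentially" for s
    unfolding filterlim_at
  proof (intro conjI)
    show "\<forall>\<^sub>F m in sequentially. r m s \<in> {s<..} \<and> r m s \<noteq> s"
      by (rule always_eventually) (use r_gt[of s] in \<open>auto simp: less_imp_neq[symmetric] less_le\<close>)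
    show "(\<lambda>m. r m s) \<longlonglongrightarrow> s"
    proof (rule tendsto_sandwich)
      show "(\<lambda>m. s) \<longlonglongrightarrow> s" by simp
      show "(\<lambda>m. s + 1 / real (Suc m)) \<longlonglongrightarrow> s" by real_asymp
    qed (use r_le less_imp_le[OF r_gt] in \<open>auto intro!: always_eventually simp del: of_nat_Suc\<close>)
  qed
  define e where "e n s = indicator {0..} s * (\<integral>\<omega>. g n (\<xi> s \<omega>) \<partial>M)" for n and s :: real
  have e_meas: "e n \<in> borel_measurable lborel" for n
  proof (rule borel_measurable_LIMSEQ_real)
    show "(\<lambda>s. indicator {0..} s * (\<lambda>k::int. \<integral>\<omega>. g n (\<xi> ((of_int k + 1) / real (Suc m)) \<omega>) \<partial>M) \<lfloor>real (Suc m) * s\<rfloor>)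
      \<in> borel_measurable lborel" for m
    proof -
      have "(\<lambda>s. indicator {0..} s * G \<lfloor>real (Suc m) * s\<rfloor>) \<in> borel_measurable lborel"
        for G :: "int \<Rightarrow> real"
        by measurable
      then show ?thesis .
    qed
    fix s :: real
    show "(\<lambda>m. indicator {0..} s * (\<lambda>k::int. \<integral>\<omega>. g n (\<xi> ((of_int k + 1) / real (Suc m)) \<omega>) \<partial>M) \<lfloor>real (Suc m) * s\<rfloor>)
      \<longlonglongrightarrow> e n s"
    proof (cases "s \<ge> 0")
      case True
      have "(\<lambda>m. \<integral>\<omega>. g n (\<xi> (r m s) \<omega>) \<partial>M) \<longlonglongrightarrow> (\<integral>\<omega>. g n (\<xi> s \<omega>) \<partial>M)"
      proof (rule integral_dominated_convergence[where w="\<lambda>_. 1"])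
        have "0 \<le> r m s" for m using r_gt[of s m] True by linarith
        note [measurable] = random_variable[OF this] random_variable[OF True]
        show "(\<lambda>\<omega>. g n (\<xi> s \<omega>)) \<in> borel_measurable M" by measurable
        show "(\<lambda>\<omega>. g n (\<xi> (r m s) \<omega>)) \<in> borel_measurable M" for m by measurable
        show "AE \<omega> in M. (\<lambda>m. g n (\<xi> (r m s) \<omega>)) \<longlonglongrightarrow> g n (\<xi> s \<omega>)"
          using cadlag
        proof eventually_elim
          case (elim \<omega>)
          then have "((\<lambda>q. \<xi> q \<omega>) \<longlongrightarrow> \<xi> s \<omega>) (at_right s)" using True by auto
          then have "(\<lambda>m. \<xi> (r m s) \<omega>) \<longlonglongrightarrow> \<xi> s \<omega>"
            using r_lim filterlim_compose by blast
          then show ?case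
            using g_cont[of n] continuous_on_tendsto_compose[of UNIV "g n"] by auto
        qed
      qed (use g_bd in auto)
      then show ?thesis using True by (simp add: e_def r_def)
    qed (simp add: e_def)
  qed
  show ?thesis
  proof (rule borel_measurable_LIMSEQ_real[OF _ e_meas])
    fix s :: real
    show "(\<lambda>n. e n s) \<longlonglongrightarrow> indicator {0..} s * measure M {\<omega> \<in> space M. \<xi> s \<omega> \<in> B}"
    proof (cases "s \<ge> 0")
      case True
      note [measurable] = random_variable[OF True]
      have "(\<lambda>n. \<integral>\<omega>. g n (\<xi> s \<omega>) \<partial>M) \<longlonglongrightarrow> (\<integral>\<omega>. indicator B (\<xi> s \<omega>) \<partial>M)"
        by (rule integral_dominated_convergence[where w="\<lambda>_. 1"]) (use g_bd g_lim in auto)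
      also have "(\<integral>\<omega>. indicator B (\<xi> s \<omega>) \<partial>M) = (\<integral>\<omega>. indicator {\<omega> \<in> space M. \<xi> s \<omega> \<in> B} \<omega> \<partial>M)"
        by (rule Bochner_Integration.integral_cong) (auto simp: indicator_def)
      also have "\<dots> = measure M {\<omega> \<in> space M. \<xi> s \<omega> \<in> B}" by simp
      finally show ?thesis using True by (simp add: e_def)
    qed (simp add: e_def)
  qed
qed

lemma measurable_marginal:
  assumes "B \<in> sets borel"
  shows "(\<lambda>s. indicator {0..} s * measure M {\<omega> \<in> space M. \<xi> s \<omega> \<in> B}) \<in> borel_measurable lborel"
proof -
  have Int_stable: "Int_stable {S :: real set. open S}"
    by (auto simp: Int_stable_def)
  have sub: "{S :: real set. open S} \<subseteq> Pow UNIV" by simp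
  have "B \<in> sigma_sets UNIV {S. open S}"
    using assms by (simp add: borel_def)
  with Int_stable sub show ?thesis
  proof (induction rule: sigma_sets_induct_disjoint)
    case (basic A) then show ?case using measurable_marginal_open by blast
  next
    case (compl A)
    then have [measurable]: "A \<in> sets borel" by (simp add: borel_def)
    have "indicator {0..} s * measure M {\<omega> \<in> space M. \<xi> s \<omega> \<in> UNIV - A} =
      indicator {0..} s * (1 - indicator {0..} s * measure M {\<omega> \<in> space M. \<xi> s \<omega> \<in> A})" for s :: real
    proof (cases "s \<ge> 0")
      case True
      note [measurable] = random_variable[OF True]
      have "{\<omega> \<in> space M. \<xi> s \<omega> \<in> UNIV - A} = space M - {\<omega> \<in> space M. \<xi> s \<omega> \<in> A}" by auto
      then show ?thesis using True by (simp add: prob_compl)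
    qed simp
    moreover have "(\<lambda>s. indicator {0..} s * (1 - indicator {0..} s * measure M {\<omega> \<in> space M. \<xi> s \<omega> \<in> A}))
        \<in> borel_measurable lborel"
      by (intro borel_measurable_times borel_measurable_diff compl(2)) auto
    ultimately show ?case by (simp only:)
  next
    case (union A)
    then have A[measurable]: "A i \<in> sets borel" for i by (auto simp: borel_def)
    have "(\<lambda>n. indicator {0..} s * measure M {\<omega> \<in> space M. \<xi> s \<omega> \<in> A n}) sums
      (indicator {0..} s * measure M {\<omega> \<in> space M. \<xi> s \<omega> \<in> \<Union>(range A)})" for s :: real
    proof (cases "s \<ge> 0")
      case True
      note [measurable] = random_variable[OF True]
      have "(\<lambda>n. measure M {\<omega> \<in> space M. \<xi> s \<omega> \<in> A n}) sums
          measure M (\<Union>n. {\<omega> \<in> space M. \<xi> s \<omega> \<in> A n})"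
        using union(1) by (intro finite_measure_UNION) (auto simp: disjoint_family_on_def)
      also have "(\<Union>n. {\<omega> \<in> space M. \<xi> s \<omega> \<in> A n}) = {\<omega> \<in> space M. \<xi> s \<omega> \<in> \<Union>(range A)}" by auto
      finally show ?thesis using True by simp
    qed simp
    then have "(\<lambda>s. indicator {0..} s * measure M {\<omega> \<in> space M. \<xi> s \<omega> \<in> \<Union>(range A)}) =
       (\<lambda>s. \<Sum>n. indicator {0..} s * measure M {\<omega> \<in> space M. \<xi> s \<omega> \<in> A n})"
      by (auto simp: sums_iff)
    moreover have "(\<lambda>s. \<Sum>n. indicator {0..} s * measure M {\<omega> \<in> space M. \<xi> s \<omega> \<in> A n})
        \<in> borel_measurable lborel"
      by (rule borel_measurable_suminf) (rule union(3))
    ultimately show ?case by (simp only:)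
  qed simp
qed

lemma emeasure_potential_measure:
  assumes "B \<in> sets borel"
  shows "emeasure (potential_measure M \<xi>) B =
    (\<integral>\<^sup>+ s\<in>{0..}. emeasure M {\<omega> \<in> space M. \<xi> s \<omega> \<in> B} \<partial>lborel)"
proof (rule emeasure_measure_of[OF potential_measure_def])
  have eq: "emeasure M {\<omega> \<in> space M. \<xi> s \<omega> \<in> C} * indicator {0..} s =
      ennreal (indicator {0..} s * measure M {\<omega> \<in> space M. \<xi> s \<omega> \<in> C})" for C s
    by (auto simp: emeasure_eq_measure indicator_def)
  show "B \<in> sets (potential_measure M \<xi>)"
    using assms sets.sigma_sets_eq[of borel]
    by (simp add: potential_measure_def sets_measure_of_conv)
  show "positive (sets (potential_measure M \<xi>))
      (\<lambda>B. \<integral>\<^sup>+ s\<in>{0..}. emeasure M {\<omega> \<in> space M. \<xi> s \<omega> \<in> B} \<partial>lborel)"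
    by (simp add: positive_def)
  show "countably_additive (sets (potential_measure M \<xi>))
      (\<lambda>B. \<integral>\<^sup>+ s\<in>{0..}. emeasure M {\<omega> \<in> space M. \<xi> s \<omega> \<in> B} \<partial>lborel)"
  proof (rule countably_additiveI)
    fix A :: "nat \<Rightarrow> real set"
    assume A: "range A \<subseteq> sets (potential_measure M \<xi>)" "disjoint_family A"
    then have [measurable]: "A i \<in> sets borel" for i
      using sets.sigma_sets_eq[of borel] by (auto simp: potential_measure_def sets_measure_of_conv)
    have sum: "(\<Sum>i. emeasure M {\<omega> \<in> space M. \<xi> s \<omega> \<in> A i} * indicator {0..} s) =
        emeasure M {\<omega> \<in> space M. \<xi> s \<omega> \<in> \<Union>(range A)} * indicator {0..} s" for s :: real
    proof (cases "s \<ge> 0")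
      case True
      note [measurable] = random_variable[OF True]
      have "(\<Sum>i. emeasure M {\<omega> \<in> space M. \<xi> s \<omega> \<in> A i}) =
          emeasure M (\<Union>i. {\<omega> \<in> space M. \<xi> s \<omega> \<in> A i})"
        using A(2) by (intro suminf_emeasure) (auto simp: disjoint_family_on_def)
      also have "(\<Union>n. {\<omega> \<in> space M. \<xi> s \<omega> \<in> A n}) = {\<omega> \<in> space M. \<xi> s \<omega> \<in> \<Union>(range A)}" by auto
      finally show ?thesis using True by simp
    qed simp
    have "(\<Sum>i. \<integral>\<^sup>+ s\<in>{0..}. emeasure M {\<omega> \<in> space M. \<xi> s \<omega> \<in> A i} \<partial>lborel) =
        (\<integral>\<^sup>+ s. (\<Sum>i. emeasure M {\<omega> \<in> space M. \<xi> s \<omega> \<in> A i} * indicator {0..} s) \<partial>lborel)"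
      by (rule nn_integral_suminf[symmetric])
        (simp only: eq, intro measurable_compose[OF measurable_marginal measurable_ennreal], simp)
    then show "(\<Sum>i. \<integral>\<^sup>+ s\<in>{0..}. emeasure M {\<omega> \<in> space M. \<xi> s \<omega> \<in> A i} \<partial>lborel) =
        (\<integral>\<^sup>+ s\<in>{0..}. emeasure M {\<omega> \<in> space M. \<xi> s \<omega> \<in> \<Union>(range A)} \<partial>lborel)"
      by (simp only: sum)
  qed
qed auto

end

end

theory Submission
  imports Defs
begin

text \<open>
  Write \<open>X = x + \<xi>\<close> and \<open>I y\<close> for the integral of \<open>f (y + \<xi> s)\<close> over all times \<open>s \<ge> 0\<close>.

  One direction is Tonelli's theorem: the potential integral over \<open>E\<close> is the expectation of the
  integral of \<open>f\<close> along \<open>X\<close> over the times that \<open>X\<close> spends in \<open>E\<close>. If it is finite and \<open>X\<close>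
  eventually stays in \<open>E\<close>, then \<open>I x\<close> is almost surely finite, because bounded time intervals
  contribute a finite amount (\<open>potential_finite_imp_AE_finite\<close>).

  For the other direction let \<open>p = P(I x < \<infinity>) > 0\<close>. The set that works is
  \<open>E = {y. P(I y \<le> 1) \<ge> p / 2}\<close>.

  \<^item> The potential integral over \<open>E\<close> is at most \<open>2 / p\<close> (\<open>potential_bound\<close>). By the Markov property
    at a fixed time \<open>s\<close>, the quantity \<open>p / 2\<close> times the expectation of \<open>f (X s)\<close> on \<open>X s \<in> E\<close> is
    at most the expectation of \<open>f (X s)\<close> on the event that the integral after time \<open>s\<close> is at most
    \<open>1\<close>; and for every single path the integral of \<open>f (X s)\<close> over all those \<open>s\<close> is at most \<open>1\<close>.

  \<^item> The path eventually stays in \<open>E\<close> (\<open>eventually_avoids_open\<close>). The function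
    \<open>u y = P(I y < \<infinity>)\<close> is a bounded harmonic function of the convolution semigroup of \<open>\<xi>\<close>, hence
    \<open>u (X t) = p\<close> almost surely by a theorem of Choquet-Deny type. So \<open>I x < \<infinity>\<close> has conditional
    probability \<open>p\<close> given any event of the past, whereas at the first entrance into the complement
    of \<open>E\<close> after time \<open>T\<close> the remaining integral is at most \<open>1\<close> with probability at most \<open>p / 2\<close>.
    Comparing the two estimates bounds the probability of such an entrance by \<open>2 / p\<close> times the probability
    that \<open>I x < \<infinity>\<close> while the integral after \<open>T\<close> exceeds \<open>1\<close>, which tends to \<open>0\<close>.

  In particular the first direction, applied to this \<open>E\<close>, upgrades \<open>P(I x < \<infinity>) > 0\<close> to
  \<open>P(I x < \<infinity>) = 1\<close>.

  First entrances are only ever taken along finite sets of times. This suffices because the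
  complement of \<open>E\<close> is open and the paths are right-continuous. Openness, i.e. lower semicontinuity
  of \<open>y \<mapsto> P(I y > 1)\<close>, is where the structure of \<open>f\<close> or of \<open>\<xi>\<close> is used. If \<open>f\<close> agrees on \<open>L\<close> with a
  supremum of non-negative combinations of indicators of open intervals, it is Fatou's lemma
  (\<open>seq_lsc_perpetual_prob_of_lsc\<close>). If the laws of \<open>\<xi> s\<close> are absolutely continuous, then translating
  the starting point acts lower semicontinuously on the probability that the integral after a small
  time exceeds \<open>1\<close>, and that time is sent to \<open>0\<close> (\<open>seq_lsc_perpetual_prob_of_ac\<close>).

  Measurability on path space is handled by passing to a version all of whose paths are
  right-continuous; such a path, and hence its perpetual integral, is a measurable function of its
  values at dyadic times.
\<close>

section \<open>Bounded harmonic functions of a convolution\<close>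

text \<open>
  A theorem of Choquet-Deny type. Let \<open>P\<close> be convolution with \<open>\<mu>\<close> and
  \<open>v = P u\<^sup>2 - u\<^sup>2\<close>, which is the mean square of \<open>u (y + z) - u y\<close> because \<open>P u = u\<close>. As \<open>P\<close> commutes
  with translations, applying harmonicity to the difference \<open>u (y + z) - u y\<close> and then Jensen's
  inequality gives \<open>v \<le> P v\<close>. So \<open>u\<^sup>2\<close> grows by at least \<open>v\<close> with every application of \<open>P\<close>, while
  staying below \<open>1\<close>; hence \<open>v = 0\<close>.
\<close>
lemma bounded_convolution_harmonic_AE_const:
  fixes u :: "real \<Rightarrow> real" and \<mu> :: "real measure"
  assumes "prob_space \<mu>" and sets[measurable_cong, simp]: "sets \<mu> = sets borel"
    and u[measurable]: "u \<in> borel_measurable borel"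
    and bd: "\<And>y. 0 \<le> u y" "\<And>y. u y \<le> 1"
    and harm: "\<And>y. u y = (\<integral>z. u (y + z) \<partial>\<mu>)"
  shows "AE z in \<mu>. u (y + z) = u y"
proof -
  interpret prob_space \<mu> by fact
  interpret P: pair_prob_space \<mu> \<mu> ..
  define w where "w y = (u y)\<^sup>2" for y
  define v where "v y = (\<integral>z. (u (y + z) - u y)\<^sup>2 \<partial>\<mu>)" for y
  have [measurable]: "w \<in> borel_measurable borel" "v \<in> borel_measurable borel"
    unfolding w_def v_def by measurable
  have w_bd: "\<bar>w y\<bar> \<le> 1" for y
    unfolding w_def using bd[of y] by (simp add: power_le_one)
  have d_bd: "\<bar>(u a - u b)\<^sup>2\<bar> \<le> 1" for a b
  proof -
    have "\<bar>u a - u b\<bar> \<le> 1" using bd[of a] bd[of b] by linarith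
    then show ?thesis by (simp add: abs_square_le_1)
  qed
  have int: "integrable \<mu> (\<lambda>z. g (y + z))"
    if [measurable]: "g \<in> borel_measurable borel" and "\<And>y. \<bar>g y\<bar> \<le> 1" for g :: "real \<Rightarrow> real" and y
    by (rule integrable_const_bound[where B = 1]) (use that in auto)
  have u_int: "integrable \<mu> (\<lambda>z. u (y + z))" for y
    by (rule int) (use bd in \<open>auto simp: abs_le_iff intro: order_trans[OF _ bd(1)]\<close>)
  have w_int: "integrable \<mu> (\<lambda>z. w (y + z))" for y by (rule int) (use w_bd in auto)
  have v_eq: "(\<integral>z. w (y + z) \<partial>\<mu>) = w y + v y" for y
  proof -
    have "v y = (\<integral>z. w (y + z) - 2 * u y * u (y + z) + w y \<partial>\<mu>)"
      unfolding v_def w_def by (intro Bochner_Integration.integral_cong) (auto simp: power2_eq_square algebra_simps)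
    also have "\<dots> = (\<integral>z. w (y + z) \<partial>\<mu>) - 2 * u y * (\<integral>z. u (y + z) \<partial>\<mu>) + w y"
      using w_int[of y] u_int[of y] by (simp add: prob_space)
    also have "\<dots> = (\<integral>z. w (y + z) \<partial>\<mu>) - w y"
      unfolding harm[symmetric] w_def by (simp add: power2_eq_square)
    finally show ?thesis by simp
  qed
  have v_nn: "0 \<le> v y" for y unfolding v_def by simp
  have v_bd: "\<bar>v y\<bar> \<le> 1" for y
  proof -
    have "(\<integral>z. w (y + z) \<partial>\<mu>) \<le> 1"
      using integral_le_const[OF w_int[of y], of 1] w_bd by (auto simp: abs_le_iff)
    moreover have "0 \<le> w y" by (simp add: w_def)
    ultimately show ?thesis using v_eq[of y] v_nn[of y] by linarith
  qed
  have v_int: "integrable \<mu> (\<lambda>z. v (y + z))" for y by (rule int) (use v_bd in auto)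
  \<comment> \<open>The subharmonicity of \<open>v\<close>, from Jensen and Fubini.\<close>
  have v_sub: "v y \<le> (\<integral>z. v (y + z) \<partial>\<mu>)" for y
  proof -
    define D where "D z z' = u (y + z' + z) - u (y + z')" for z z'
    have [measurable]: "case_prod D \<in> borel_measurable (\<mu> \<Otimes>\<^sub>M \<mu>)" unfolding D_def by measurable
    have D2: "integrable (\<mu> \<Otimes>\<^sub>M \<mu>) (case_prod (\<lambda>z z'. (D z z')\<^sup>2))"
      by (rule P.integrable_const_bound[where B = 1]) (use d_bd in \<open>auto simp: D_def\<close>)
    have step: "(u (y + z) - u y)\<^sup>2 \<le> (\<integral>z'. (D z z')\<^sup>2 \<partial>\<mu>)" for z
    proof -
      have i1: "integrable \<mu> (\<lambda>z'. u (y + z' + z))"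
        using u_int[of "y + z"] by (simp add: algebra_simps)
      have i2: "integrable \<mu> (D z)" unfolding D_def using i1 u_int by simp
      have i3: "integrable \<mu> (\<lambda>z'. (D z z')\<^sup>2)"
        by (rule integrable_const_bound[where B = 1]) (use d_bd in \<open>auto simp: D_def\<close>)
      have "u (y + z) - u y = (\<integral>z'. D z z' \<partial>\<mu>)"
      proof -
        have "(\<integral>z'. D z z' \<partial>\<mu>) = (\<integral>z'. u (y + z' + z) \<partial>\<mu>) - (\<integral>z'. u (y + z') \<partial>\<mu>)"
          unfolding D_def using i1 u_int by (rule Bochner_Integration.integral_diff)
        also have "(\<integral>z'. u (y + z' + z) \<partial>\<mu>) = u (y + z)"
          unfolding harm[of "y + z"] by (simp add: add_ac)
        finally show ?thesis using harm[of y] by simp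
      qed
      also have "\<dots>\<^sup>2 \<le> (\<integral>z'. (D z z')\<^sup>2 \<partial>\<mu>)"
        using variance_eq[OF i2 i3] variance_positive[of "D z"] by simp
      finally show ?thesis .
    qed
    have "v y \<le> (\<integral>z. (\<integral>z'. (D z z')\<^sup>2 \<partial>\<mu>) \<partial>\<mu>)"
      unfolding v_def
    proof (rule integral_mono[OF _ _ step])
      show "integrable \<mu> (\<lambda>z. (u (y + z) - u y)\<^sup>2)"
        by (rule integrable_const_bound[where B = 1]) (use d_bd in auto)
      show "integrable \<mu> (\<lambda>z. \<integral>z'. (D z z')\<^sup>2 \<partial>\<mu>)"
        using P.integrable_fst'[OF D2] by simp
    qed
    also have "\<dots> = (\<integral>z'. (\<integral>z. (D z z')\<^sup>2 \<partial>\<mu>) \<partial>\<mu>)"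
      using P.Fubini_integral[OF D2] by simp
    also have "\<dots> = (\<integral>z'. v (y + z') \<partial>\<mu>)" unfolding D_def v_def by simp
    finally show ?thesis .
  qed
  define Q where "Q n = ((\<lambda>g y. \<integral>z. g (y + z) \<partial>\<mu>) ^^ n) w" for n :: nat
  have Q: "Q n \<in> borel_measurable borel \<and> (\<forall>y. \<bar>Q n y\<bar> \<le> 1 \<and> w y + n * v y \<le> Q n y)" for n
  proof (induction n)
    case 0 then show ?case using w_bd by (simp add: Q_def)
  next
    case (Suc n)
    then have [measurable]: "Q n \<in> borel_measurable borel" by simp
    have Q_int: "integrable \<mu> (\<lambda>z. Q n (y + z))" for y by (rule int) (use Suc in auto)
    have eq: "Q (Suc n) = (\<lambda>y. \<integral>z. Q n (y + z) \<partial>\<mu>)" by (simp add: Q_def)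
    have "Q (Suc n) \<in> borel_measurable borel" unfolding eq by measurable
    moreover have "\<bar>Q (Suc n) y\<bar> \<le> 1" for y
    proof -
      have "(\<integral>z. Q n (y + z) \<partial>\<mu>) \<le> 1"
        by (rule integral_le_const[OF Q_int]) (use Suc in \<open>auto simp: abs_le_iff\<close>)
      moreover have "-1 \<le> (\<integral>z. Q n (y + z) \<partial>\<mu>)"
        by (rule integral_ge_const[OF Q_int])
          (use Suc in \<open>force simp: abs_le_iff intro!: AE_I2\<close>)
      ultimately show ?thesis by (simp add: eq)
    qed
    moreover have "w y + Suc n * v y \<le> Q (Suc n) y" for y
    proof -
      have "w y + Suc n * v y \<le> (w y + v y) + n * (\<integral>z. v (y + z) \<partial>\<mu>)"
        using v_sub[of y] mult_left_mono[OF v_sub[of y], of "real n"] by (simp add: algebra_simps)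
      also have "\<dots> = (\<integral>z. w (y + z) + n * v (y + z) \<partial>\<mu>)"
        using v_eq[of y] w_int v_int by simp
      also have "\<dots> \<le> Q (Suc n) y"
        unfolding eq by (rule integral_mono) (use Suc Q_int w_int v_int in auto)
      finally show ?thesis .
    qed
    ultimately show ?case by simp
  qed
  have "v y = 0"
  proof (rule ccontr)
    assume "v y \<noteq> 0"
    then have "0 < v y" using v_nn[of y] by simp
    then obtain n :: nat where "1 < n * v y" using reals_Archimedean3 by blast
    moreover have "0 \<le> w y" by (simp add: w_def)
    ultimately show False using Q[of n] by (auto simp: abs_le_iff not_less[symmetric] dest!: spec[of _ y])
  qed
  moreover have "integrable \<mu> (\<lambda>z. (u (y + z) - u y)\<^sup>2)"
    by (rule integrable_const_bound[where B = 1]) (use d_bd in auto)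
  ultimately show ?thesis
    unfolding v_def by (subst (asm) integral_nonneg_eq_0_iff_AE) auto
qed

section \<open>Tail masses and cadlag functions\<close>

text \<open>
  The set is an up-set of \<open>{0..}\<close>, so it is exhausted by tails \<open>{t..}\<close> with \<open>t\<close> in the set, each of
  mass at most \<open>c\<close>.
\<close>
lemma emeasure_tail_le_const:
  fixes \<nu> :: "real measure"
  assumes [measurable_cong, simp]: "sets \<nu> = sets borel"
  shows "emeasure \<nu> {s. 0 \<le> s \<and> emeasure \<nu> {s..} \<le> c} \<le> c"
proof -
  define A where "A = {s. 0 \<le> s \<and> emeasure \<nu> {s..} \<le> c}"
  have up: "t \<in> A" if "s \<in> A" "s \<le> t" for s t
  proof -
    have "emeasure \<nu> {t..} \<le> emeasure \<nu> {s..}" using that by (intro emeasure_mono) auto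
    then show ?thesis using that unfolding A_def by (auto intro: order_trans)
  qed
  show ?thesis
  proof (cases "A = {}")
    case True then show ?thesis by (metis A_def emeasure_empty zero_le)
  next
    case False
    define i where "i = Inf A"
    have bdd: "bdd_below A" unfolding A_def by (rule bdd_belowI[of _ 0]) auto
    have le: "i \<le> s" if "s \<in> A" for s unfolding i_def using bdd that by (rule cInf_lower[rotated])
    have gt: "s \<in> A" if "i < s" for s
      using that cInf_lessD[OF False, of s] up unfolding i_def by (meson less_imp_le)
    show ?thesis
    proof (cases "i \<in> A")
      case True
      then have "emeasure \<nu> A \<le> emeasure \<nu> {i..}" using le by (intro emeasure_mono) auto
      then show ?thesis using True unfolding A_def by (auto intro: order_trans)
    next
      case False
      have A_eq: "A = (\<Union>k. {i + 1 / Suc k..})"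
      proof (intro set_eqI iffI)
        fix s assume "s \<in> A"
        then have "0 < s - i" using le[of s] False by (auto simp: less_le)
        then obtain k where "1 / Suc k < s - i" using nat_approx_posE by blast
        then have "s \<in> {i + 1 / Suc k..}" by simp
        then show "s \<in> (\<Union>k. {i + 1 / Suc k..})" by blast
      next
        fix s assume "s \<in> (\<Union>k. {i + 1 / Suc k..})"
        then obtain k where "i + 1 / Suc k \<le> s" by auto
        then have "i < s" by (rule less_le_trans[rotated]) simp
        then show "s \<in> A" by (rule gt)
      qed
      have "emeasure \<nu> A = (SUP k. emeasure \<nu> {i + 1 / Suc k..})"
        unfolding A_eq
      proof (rule SUP_emeasure_incseq[symmetric])
        show "incseq (\<lambda>k. {i + 1 / Suc k..})"
        proof (rule incseq_SucI)
          fix k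
          have "1 / real (Suc (Suc k)) \<le> 1 / real (Suc k)" by (intro divide_left_mono) auto
          then show "{i + 1 / Suc k..} \<subseteq> {i + 1 / Suc (Suc k)..}" by (auto simp del: of_nat_Suc)
        qed
      qed auto
      also have "\<dots> \<le> c"
      proof (rule SUP_least)
        fix k :: nat
        have "i + 1 / Suc k \<in> A" by (rule gt) simp
        then show "emeasure \<nu> {i + 1 / Suc k..} \<le> c" by (simp add: A_def)
      qed
      finally show ?thesis unfolding A_def .
    qed
  qed
qed

text \<open>
  Each point has a neighbourhood on which \<open>g\<close> is bounded, by the one-sided limits; the Bolzano
  principle glues these bounds together on a compact interval. Intersecting with \<open>{0..}\<close> removes the
  times at which nothing is known about \<open>g\<close>.
\<close>
lemma cadlag_imp_bounded:
  fixes g :: "real \<Rightarrow> real"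
  assumes right: "\<And>s. 0 \<le> s \<Longrightarrow> (g \<longlongrightarrow> g s) (at_right s)"
    and left: "\<And>s. 0 < s \<Longrightarrow> \<exists>l. (g \<longlongrightarrow> l) (at_left s)"
  shows "bounded (g ` {0..t})"
proof (cases "0 \<le> t")
  case True
  have loc: "\<exists>d>0. bounded (g ` {a<..<a + d})" if "0 \<le> a" for a
  proof -
    have "\<forall>\<^sub>F r in at_right a. dist (g r) (g a) < 1"
      using right[OF that] by (rule tendstoD) simp
    then obtain b where "a < b" and b: "\<And>r. a < r \<Longrightarrow> r < b \<Longrightarrow> dist (g r) (g a) < 1"
      by (auto simp: eventually_at_right_field)
    then have "g ` {a<..<a + (b - a)} \<subseteq> ball (g a) 1" by (auto simp: dist_commute)
    then show ?thesis using \<open>a < b\<close> bounded_subset[OF bounded_ball] by (meson diff_gt_0_iff_gt)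
  qed
  have locl: "\<exists>d>0. bounded (g ` ({a - d<..<a} \<inter> {0..}))" if "0 \<le> a" for a
  proof (cases "a = 0")
    case True
    then have "{a - 1<..<a} \<inter> {0..} = {}" by auto
    then show ?thesis by (intro exI[of _ 1]) auto
  next
    case False
    with that have "0 < a" by simp
    from left[OF this] obtain l where "(g \<longlongrightarrow> l) (at_left a)" by blast
    then have "\<forall>\<^sub>F r in at_left a. dist (g r) l < 1" by (rule tendstoD) simp
    then obtain b where "b < a" and b: "\<And>r. b < r \<Longrightarrow> r < a \<Longrightarrow> dist (g r) l < 1"
      by (auto simp: eventually_at_left_field)
    then have "g ` ({a - (a - b)<..<a} \<inter> {0..}) \<subseteq> ball l 1" by (auto simp: dist_commute)
    then show ?thesis using \<open>b < a\<close> bounded_subset[OF bounded_ball] by (meson diff_gt_0_iff_gt)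
  qed
  show ?thesis
    using True
  proof (rule Bolzano[where P = "\<lambda>a b. bounded (g ` ({a..b} \<inter> {0..}))", of 0 t, THEN bounded_subset])
    show "bounded (g ` ({a..c} \<inter> {0..}))"
      if "bounded (g ` ({a..b} \<inter> {0..}))" "bounded (g ` ({b..c} \<inter> {0..}))" "a \<le> b" "b \<le> c" for a b c :: real
    proof -
      have "g ` ({a..c} \<inter> {0..}) \<subseteq> g ` ({a..b} \<inter> {0..}) \<union> g ` ({b..c} \<inter> {0..})"
        unfolding image_Un[symmetric] by (rule image_mono) auto
      then show ?thesis using that bounded_Un bounded_subset by blast
    qed
    fix x :: real assume "0 \<le> x"
    obtain d where d: "0 < d" "bounded (g ` {x<..<x + d})" using loc[OF \<open>0 \<le> x\<close>] by auto
    obtain e where e: "0 < e" "bounded (g ` ({x - e<..<x} \<inter> {0..}))" using locl[OF \<open>0 \<le> x\<close>] by auto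
    have "bounded (g ` ({a..b} \<inter> {0..}))" if "a \<le> x" "x \<le> b" "b - a < min d e" for a b
    proof -
      have "g ` ({a..b} \<inter> {0..}) \<subseteq> g ` ({x - e<..<x} \<inter> {0..}) \<union> {g x} \<union> g ` {x<..<x + d}"
      proof
        fix y assume "y \<in> g ` ({a..b} \<inter> {0..})"
        then obtain r where r: "y = g r" "a \<le> r" "r \<le> b" "0 \<le> r" by auto
        consider "r < x" | "r = x" | "x < r" by linarith
        then show "y \<in> g ` ({x - e<..<x} \<inter> {0..}) \<union> {g x} \<union> g ` {x<..<x + d}"
          using r that by cases auto
      qed
      moreover have "bounded (g ` ({x - e<..<x} \<inter> {0..}) \<union> {g x} \<union> g ` {x<..<x + d})"
        using d(2) e(2) by simp
      ultimately show ?thesis by (rule bounded_subset[rotated])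
    qed
    then show "\<exists>d>0. \<forall>a b. a \<le> x \<and> x \<le> b \<and> b - a < d \<longrightarrow> bounded (g ` ({a..b} \<inter> {0..}))"
      using d(1) e(1) by (intro exI[of _ "min d e"]) auto
  qed auto
qed simp

section \<open>Sequential lower semicontinuity\<close>

definition seq_lsc :: "(real \<Rightarrow> ennreal) \<Rightarrow> bool" where
  "seq_lsc q \<longleftrightarrow> (\<forall>Y y. Y \<longlonglongrightarrow> y \<longrightarrow> q y \<le> liminf (\<lambda>k. q (Y k)))"

lemma seq_lsc_SUP:
  assumes "\<And>i. i \<in> I \<Longrightarrow> seq_lsc (q i)"
  shows "seq_lsc (\<lambda>y. SUP i\<in>I. q i y)"
  unfolding seq_lsc_def
proof (intro allI impI SUP_least)
  fix Y y i assume "Y \<longlonglongrightarrow> (y :: real)" "i \<in> I"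
  then have "q i y \<le> liminf (\<lambda>k. q i (Y k))" using assms by (auto simp: seq_lsc_def)
  also have "\<dots> \<le> liminf (\<lambda>k. SUP i\<in>I. q i (Y k))"
    using \<open>i \<in> I\<close> by (intro Liminf_mono always_eventually allI SUP_upper)
  finally show "q i y \<le> liminf (\<lambda>k. SUP i\<in>I. q i (Y k))" .
qed

lemma seq_lsc_nn_integral:
  assumes "\<And>\<omega>. \<omega> \<in> space M \<Longrightarrow> seq_lsc (\<lambda>y. q y \<omega>)" and "\<And>y. q y \<in> borel_measurable M"
  shows "seq_lsc (\<lambda>y. \<integral>\<^sup>+ \<omega>. q y \<omega> \<partial>M)"
  unfolding seq_lsc_def
proof (intro allI impI)
  fix Y y assume "Y \<longlonglongrightarrow> (y :: real)"
  then have "(\<integral>\<^sup>+ \<omega>. q y \<omega> \<partial>M) \<le> (\<integral>\<^sup>+ \<omega>. liminf (\<lambda>k. q (Y k) \<omega>) \<partial>M)"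
    using assms(1) by (intro nn_integral_mono) (auto simp: seq_lsc_def)
  also have "\<dots> \<le> liminf (\<lambda>k. \<integral>\<^sup>+ \<omega>. q (Y k) \<omega> \<partial>M)"
    by (rule nn_integral_liminf) (rule assms(2))
  finally show "(\<integral>\<^sup>+ \<omega>. q y \<omega> \<partial>M) \<le> liminf (\<lambda>k. \<integral>\<^sup>+ \<omega>. q (Y k) \<omega> \<partial>M)" .
qed

lemma seq_lsc_indicator:
  assumes "seq_lsc q"
  shows "seq_lsc (\<lambda>y. indicator {c<..} (q y))"
  unfolding seq_lsc_def
proof (intro allI impI)
  fix Y y assume Y: "Y \<longlonglongrightarrow> (y :: real)"
  show "indicator {c<..} (q y) \<le> liminf (\<lambda>k. indicator {c<..} (q (Y k)) :: ennreal)"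
  proof (cases "c < q y")
    case True
    then have "c < liminf (\<lambda>k. q (Y k))" using assms Y unfolding seq_lsc_def by (auto intro: less_le_trans)
    then have "\<forall>\<^sub>F k in sequentially. c < q (Y k)" by (rule less_LiminfD)
    then have "\<forall>\<^sub>F k in sequentially. 1 \<le> (indicator {c<..} (q (Y k)) :: ennreal)"
      by eventually_elim simp
    then show ?thesis using True by (intro Liminf_bounded) auto
  qed simp
qed

lemma seq_lsc_imp_open:
  assumes "seq_lsc q"
  shows "open {y. c < q y}"
proof -
  have "closed {y. q y \<le> c}"
    unfolding closed_sequential_limits
  proof (intro allI impI)
    fix Y y assume "(\<forall>n. Y n \<in> {y. q y \<le> c}) \<and> Y \<longlonglongrightarrow> y"
    then have Y: "\<And>n. q (Y n) \<le> c" and "Y \<longlonglongrightarrow> y" by auto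
    then have "q y \<le> liminf (\<lambda>k. q (Y k))" using assms by (auto simp: seq_lsc_def)
    also have "\<dots> \<le> liminf (\<lambda>k. c)" using Y by (intro Liminf_mono always_eventually) auto
    finally show "y \<in> {y. q y \<le> c}" by (simp add: Liminf_const)
  qed
  moreover have "{y. c < q y} = - {y. q y \<le> c}" by auto
  ultimately show ?thesis by (simp add: open_closed)
qed

lemma seq_lsc_indicator_open:
  assumes "open S"
  shows "seq_lsc (\<lambda>y. c * indicator S y)"
  unfolding seq_lsc_def
proof (intro allI impI)
  fix Y y assume Y: "Y \<longlonglongrightarrow> (y :: real)"
  show "c * indicator S y \<le> liminf (\<lambda>k. c * indicator S (Y k))"
  proof (cases "y \<in> S")
    case True
    have "\<forall>\<^sub>F k in sequentially. Y k \<in> S" by (rule topological_tendstoD[OF Y assms True])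
    then have "\<forall>\<^sub>F k in sequentially. c \<le> c * indicator S (Y k)"
      by eventually_elim simp
    then show ?thesis using True by (intro Liminf_bounded) auto
  qed simp
qed

lemma seq_lsc_shift:
  assumes "seq_lsc q" shows "seq_lsc (\<lambda>y. q (y + a))"
  unfolding seq_lsc_def
proof (intro allI impI)
  fix Y y assume "Y \<longlonglongrightarrow> (y :: real)"
  then have "(\<lambda>k. Y k + a) \<longlonglongrightarrow> y + a" by (intro tendsto_intros)
  then show "q (y + a) \<le> liminf (\<lambda>k. q (Y k + a))"
    using assms unfolding seq_lsc_def by (auto dest!: spec)
qed

text \<open>
  Otherwise sets of Lebesgue measure at most \<open>2\<^sup>-\<^sup>k\<close> would all have \<open>\<mu>\<close>-mass above \<open>e\<close>; their upper
  limit would be a Lebesgue null set by Borel-Cantelli, yet have \<open>\<mu>\<close>-mass at least \<open>e\<close>.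
\<close>
lemma finite_measure_uniformly_absolutely_continuous:
  fixes \<mu> :: "real measure"
  assumes "finite_measure \<mu>" and [measurable_cong, simp]: "sets \<mu> = sets borel"
    and ac: "\<And>A. A \<in> null_sets lborel \<Longrightarrow> emeasure \<mu> A = 0"
    and "0 < e"
  shows "\<exists>d::real>0. \<forall>A\<in>sets borel. emeasure lborel A < d \<longrightarrow> emeasure \<mu> A \<le> ennreal e"
proof (rule ccontr)
  interpret finite_measure \<mu> by fact
  assume "\<not> ?thesis"
  then have "\<exists>A\<in>sets borel. emeasure lborel A < ennreal ((1/2)^k) \<and> ennreal e < emeasure \<mu> A" for k :: nat
    by (auto simp: not_le dest!: spec[of _ "(1/2)^k"])
  then obtain A where A[measurable]: "\<And>k. A k \<in> sets borel"
    and small: "\<And>k. emeasure lborel (A k) < ennreal ((1/2)^k)"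
    and large: "\<And>k. ennreal e < emeasure \<mu> (A k)"
    by metis
  have "summable (\<lambda>k. measure lborel (A k))"
  proof (rule summable_comparison_test)
    have "measure lborel (A k) \<le> (1/2)^k" for k
      using small[of k] unfolding measure_def by (intro enn2real_leI) auto
    then show "\<exists>N. \<forall>n\<ge>N. norm (measure lborel (A n)) \<le> (1/2)^n" by auto
  qed (simp add: summable_geometric)
  then have "limsup A \<in> null_sets lborel"
    using small by (intro borel_cantelli_limsup1) (auto intro: less_trans[OF _ ennreal_less_top])
  then have "emeasure \<mu> (limsup A) = 0" by (rule ac)
  moreover have "emeasure \<mu> (limsup A) = (INF n. emeasure \<mu> (\<Union>k\<in>{n..}. A k))"
    unfolding limsup_INF_SUP
    by (rule INF_emeasure_decseq[symmetric])
      (auto simp: decseq_def intro: le_trans)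
  moreover have "ennreal e \<le> (INF n. emeasure \<mu> (\<Union>k\<in>{n..}. A k))"
  proof (rule INF_greatest)
    fix n :: nat
    have "emeasure \<mu> (A n) \<le> emeasure \<mu> (\<Union>k\<in>{n..}. A k)" by (intro emeasure_mono) auto
    then show "ennreal e \<le> emeasure \<mu> (\<Union>k\<in>{n..}. A k)" using large[of n] by auto
  qed
  ultimately show False using \<open>0 < e\<close> by simp
qed

text \<open>
  For open \<open>B\<close> this is Fatou's lemma. A Borel set is approximated from outside by an open \<open>U\<close> with
  \<open>U - B\<close> of small Lebesgue measure; since Lebesgue measure is translation invariant, the error is
  small uniformly in the translation parameter, by uniform absolute continuity of \<open>\<mu>\<close>.
\<close>
lemma seq_lsc_translate:
  fixes \<mu> :: "real measure"
  assumes "finite_measure \<mu>" and [measurable_cong, simp]: "sets \<mu> = sets borel"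
    and ac: "\<And>A. A \<in> null_sets lborel \<Longrightarrow> emeasure \<mu> A = 0"
    and B[measurable]: "B \<in> sets borel"
  shows "seq_lsc (\<lambda>y. emeasure \<mu> {z. y + z \<in> B})"
  unfolding seq_lsc_def
proof (intro allI impI, rule ennreal_le_epsilon)
  fix Y y and e :: real assume Y: "Y \<longlonglongrightarrow> (y :: real)" and e: "0 < e"
  have sp: "space \<mu> = UNIV" using sets_eq_imp_space_eq[OF assms(2)] by simp
  obtain d :: real where d: "0 < d" "\<And>A. A \<in> sets borel \<Longrightarrow> emeasure lborel A < d \<Longrightarrow> emeasure \<mu> A \<le> ennreal e"
    using finite_measure_uniformly_absolutely_continuous[OF assms(1-3) e] by blast
  obtain U where U: "open U" "B \<subseteq> U" "emeasure lborel (U - B) < d"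
    using outer_regular_lborel[OF B d(1)] by blast
  then have [measurable]: "U \<in> sets borel" by simp
  have shift: "emeasure lborel {z. a + z \<in> C} = emeasure lborel C" if [measurable]: "C \<in> sets borel" for a and C :: "real set"
  proof -
    have "emeasure lborel C = emeasure (distr lborel borel ((+) a)) C" by (simp add: lborel_distr_plus)
    also have "\<dots> = emeasure lborel {z. a + z \<in> C}" by (subst emeasure_distr) (auto simp: vimage_def)
    finally show ?thesis by simp
  qed
  have U_eq: "emeasure \<mu> {z. a + z \<in> U} = (\<integral>\<^sup>+ z. indicator U (a + z) \<partial>\<mu>)" for a
  proof -
    have "emeasure \<mu> {z. a + z \<in> U} = (\<integral>\<^sup>+ z. indicator {z. a + z \<in> U} z \<partial>\<mu>)"
      by (rule nn_integral_indicator[symmetric]) simp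
    also have "\<dots> = (\<integral>\<^sup>+ z. indicator U (a + z) \<partial>\<mu>)"
      by (intro nn_integral_cong) (auto simp: indicator_def)
    finally show ?thesis .
  qed
  have "emeasure \<mu> {z. y + z \<in> B} \<le> emeasure \<mu> {z. y + z \<in> U}"
    using U(2) by (intro emeasure_mono) (auto simp: sp)
  also have "\<dots> = (\<integral>\<^sup>+ z. indicator U (y + z) \<partial>\<mu>)" by (rule U_eq)
  also have "\<dots> \<le> liminf (\<lambda>k. \<integral>\<^sup>+ z. indicator U (Y k + z) \<partial>\<mu>)"
  proof -
    have "seq_lsc (\<lambda>y. \<integral>\<^sup>+ z. indicator U (y + z) \<partial>\<mu>)"
      using seq_lsc_shift[OF seq_lsc_indicator_open[OF U(1), of 1]]
      by (intro seq_lsc_nn_integral) auto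
    then show ?thesis using Y by (simp add: seq_lsc_def)
  qed
  also have "\<dots> \<le> liminf (\<lambda>k. emeasure \<mu> {z. Y k + z \<in> B} + ennreal e)"
  proof (intro Liminf_mono always_eventually allI)
    fix k
    have "(\<integral>\<^sup>+ z. indicator U (Y k + z) \<partial>\<mu>) = emeasure \<mu> {z. Y k + z \<in> U}"
      by (rule U_eq[symmetric])
    also have "\<dots> \<le> emeasure \<mu> ({z. Y k + z \<in> B} \<union> {z. Y k + z \<in> U - B})"
      by (intro emeasure_mono) auto
    also have "\<dots> \<le> emeasure \<mu> {z. Y k + z \<in> B} + emeasure \<mu> {z. Y k + z \<in> U - B}"
      by (rule emeasure_subadditive) auto
    also have "emeasure \<mu> {z. Y k + z \<in> U - B} \<le> ennreal e"
    proof (rule d(2))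
      have UB[measurable]: "U - B \<in> sets borel" by simp
      show "{z. Y k + z \<in> U - B} \<in> sets borel" by measurable
      show "emeasure lborel {z. Y k + z \<in> U - B} < ennreal d"
        unfolding shift[OF UB] by (rule U(3))
    qed
    finally show "(\<integral>\<^sup>+ z. indicator U (Y k + z) \<partial>\<mu>) \<le> emeasure \<mu> {z. Y k + z \<in> B} + ennreal e"
      by (simp add: add_left_mono)
  qed
  also have "\<dots> = liminf (\<lambda>k. emeasure \<mu> {z. Y k + z \<in> B}) + ennreal e"
    by (intro Liminf_add_const) auto
  finally show "emeasure \<mu> {z. y + z \<in> B} \<le> liminf (\<lambda>k. emeasure \<mu> {z. Y k + z \<in> B}) + ennreal e" .
qed

section \<open>Dyadic skeletons of right-continuous paths\<close>

definition dyadics :: "real set" where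
  "dyadics = (\<Union>m k. {real (k :: nat) / 2 ^ (m :: nat)})"

text \<open>
  The summand \<open>1\<close> makes the approximating dyadic strictly larger than \<open>s\<close>, so that
  right-continuity of a path at \<open>s\<close> applies.
\<close>
definition dyadic_above :: "nat \<Rightarrow> real \<Rightarrow> real" where
  "dyadic_above m s = real (nat \<lfloor>2 ^ m * s\<rfloor> + 1) / 2 ^ m"

lemma dyadic_above_in_dyadics: "dyadic_above m s \<in> dyadics"
  unfolding dyadics_def dyadic_above_def by blast

lemma filterlim_dyadic_above:
  assumes "0 \<le> s"
  shows "filterlim (\<lambda>m. dyadic_above m s) (at_right s) sequentially"
  unfolding filterlim_at
proof (intro conjI)
  have eq: "real (nat \<lfloor>2 ^ m * s\<rfloor>) = of_int \<lfloor>2 ^ m * s\<rfloor>" for m :: nat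
    using assms by simp
  have gt: "s < dyadic_above m s" for m
    unfolding dyadic_above_def of_nat_add eq by (simp add: field_simps) linarith
  have le: "dyadic_above m s \<le> s + 1 / 2 ^ m" for m
  proof -
    have "dyadic_above m s \<le> (2 ^ m * s + 1) / 2 ^ m"
      unfolding dyadic_above_def of_nat_add eq
      by (intro divide_right_mono add_mono of_int_floor_le) auto
    then show ?thesis by (simp add: add_divide_distrib)
  qed
  show "\<forall>\<^sub>F m in sequentially. dyadic_above m s \<in> {s<..} \<and> dyadic_above m s \<noteq> s"
    using gt by (intro always_eventually allI) (auto simp: less_imp_neq[symmetric] dest: less_imp_neq)
  show "(\<lambda>m. dyadic_above m s) \<longlonglongrightarrow> s"
  proof (rule tendsto_sandwich)
    show "(\<lambda>m. s) \<longlonglongrightarrow> s" by simp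
    show "(\<lambda>m. s + 1 / 2 ^ m) \<longlonglongrightarrow> s" by real_asymp
  qed (use le less_imp_le[OF gt] in \<open>auto intro!: always_eventually\<close>)
qed

lemma finite_dyadics_common_denominator:
  assumes "finite J" "J \<subseteq> dyadics"
  obtains m :: nat and k :: "real \<Rightarrow> nat" where "\<And>q. q \<in> J \<Longrightarrow> q = real (k q) / 2 ^ m"
proof -
  have "\<exists>m (k :: real \<Rightarrow> nat). \<forall>q\<in>J. q = real (k q) / 2 ^ m"
    using assms
  proof (induction J)
    case (insert q J)
    then obtain m and k :: "real \<Rightarrow> nat" where mk: "\<forall>q\<in>J. q = real (k q) / 2 ^ m" by auto
    obtain n and l :: nat where q: "q = real l / 2 ^ n" using insert.prems by (auto simp: dyadics_def)
    show ?case
    proof (intro exI[of _ "m + n"] exI[of _ "\<lambda>r. if r = q then l * 2 ^ m else k r * 2 ^ n"] ballI)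
      fix r assume "r \<in> insert q J"
      then show "r = real (if r = q then l * 2 ^ m else k r * 2 ^ n) / 2 ^ (m + n)"
        using mk q by (auto simp: power_add)
    qed
  qed auto
  then show ?thesis using that by blast
qed

definition path_space :: "(real \<Rightarrow> real) measure" where
  "path_space = PiM dyadics (\<lambda>_. borel)"

text \<open>
  The path with dyadic values \<open>w\<close>. For a right-continuous path the limit exists; on the rest of the
  path space its value is arbitrary but depends measurably on \<open>w\<close>.
\<close>
definition path_of :: "(real \<Rightarrow> real) \<Rightarrow> real \<Rightarrow> real" where
  "path_of w s = lim (\<lambda>m. w (dyadic_above m s))"

definition path_integral :: "(real \<Rightarrow> ennreal) \<Rightarrow> real \<Rightarrow> (real \<Rightarrow> real) \<Rightarrow> ennreal" where
  "path_integral g y w = (\<integral>\<^sup>+ s\<in>{0..}. g (y + path_of w s) \<partial>lborel)"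

lemma measurable_path_of[measurable]:
  "(\<lambda>(s, w). path_of w s) \<in> borel_measurable (borel \<Otimes>\<^sub>M path_space)"
proof -
  have "(\<lambda>x. snd x (dyadic_above m (fst x))) \<in> borel_measurable (borel \<Otimes>\<^sub>M path_space)" for m
    unfolding dyadic_above_def
  proof (rule measurable_compose_countable[where f = "\<lambda>i x. snd x (real (i + 1) / 2 ^ m)" and g = "\<lambda>x. nat \<lfloor>2 ^ m * fst x\<rfloor>"])
    show "(\<lambda>x. snd x (real (i + 1) / 2 ^ m)) \<in> borel_measurable (borel \<Otimes>\<^sub>M path_space)" for i :: nat
    proof -
      have "real (i + 1) / 2 ^ m \<in> dyadics" unfolding dyadics_def by blast
      then show ?thesis
        unfolding path_space_def by (intro measurable_compose[OF measurable_snd] measurable_component_singleton)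
    qed
  qed measurable
  then show ?thesis unfolding path_of_def case_prod_beta by (rule borel_measurable_lim_metric)
qed

lemma measurable_path_integral[measurable]:
  assumes [measurable]: "g \<in> borel_measurable borel"
  shows "(\<lambda>(y, w). path_integral g y w) \<in> borel_measurable (borel \<Otimes>\<^sub>M path_space)"
  unfolding path_integral_def by measurable

section \<open>The Markov property\<close>

text \<open>
  A Levy process whose paths start at \<open>0\<close> and are right-continuous without exception. The time
  index ranges over all reals, so that no side condition is attached to measurability and to
  right-continuity.
\<close>
locale right_continuous_levy = prob_space M for M :: "'a measure" +
  fixes Y :: "real \<Rightarrow> 'a \<Rightarrow> real"
  assumes random_variable[measurable]: "\<And>s. Y s \<in> borel_measurable M"
    and start: "\<And>\<omega>. \<omega> \<in> space M \<Longrightarrow> Y 0 \<omega> = 0"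
    and right_continuous: "\<And>\<omega> s. \<omega> \<in> space M \<Longrightarrow> ((\<lambda>r. Y r \<omega>) \<longlongrightarrow> Y s \<omega>) (at_right s)"
    and independent_increments: "\<And>t n. 0 \<le> t 0 \<Longrightarrow> (\<And>i. t i \<le> t (Suc i)) \<Longrightarrow>
        indep_vars (\<lambda>_. borel) (\<lambda>i \<omega>. Y (t (Suc i)) \<omega> - Y (t i) \<omega>) {..<n::nat}"
    and stationary_increments: "\<And>s h. 0 \<le> s \<Longrightarrow> 0 \<le> h \<Longrightarrow>
        distr M borel (\<lambda>\<omega>. Y (s + h) \<omega> - Y s \<omega>) = distr M borel (Y h)"
begin

text \<open>
  The increments after time \<open>t\<close>, recorded at dyadic time distances. This is a random element of the
  countable product \<open>path_space\<close>, from which all increments after \<open>t\<close> can be recovered.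
\<close>
definition future :: "real \<Rightarrow> 'a \<Rightarrow> real \<Rightarrow> real" where
  "future t \<omega> = (\<lambda>q\<in>dyadics. Y (t + q) \<omega> - Y t \<omega>)"

definition path_law :: "(real \<Rightarrow> real) measure" where
  "path_law = distr M path_space (future 0)"

lemma measurable_future[measurable]: "future t \<in> measurable M path_space"
  unfolding future_def path_space_def by measurable

lemma prob_space_path_law: "prob_space path_law"
  unfolding path_law_def by (rule prob_space_distr) measurable

lemma sets_path_law[measurable_cong, simp]: "sets path_law = sets path_space"
  by (simp add: path_law_def)

lemma path_of_future:
  assumes "\<omega> \<in> space M" "0 \<le> s"
  shows "path_of (future t \<omega>) s = Y (t + s) \<omega> - Y t \<omega>"
proof -
  have "filterlim (\<lambda>m. t + dyadic_above m s) (at_right (t + s)) sequentially"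
    using filterlim_dyadic_above[OF assms(2)]
    by (auto simp: filterlim_at intro!: tendsto_intros)
  then have "(\<lambda>m. Y (t + dyadic_above m s) \<omega>) \<longlonglongrightarrow> Y (t + s) \<omega>"
    using right_continuous[OF assms(1)] filterlim_compose by blast
  then have "(\<lambda>m. Y (t + dyadic_above m s) \<omega> - Y t \<omega>) \<longlonglongrightarrow> Y (t + s) \<omega> - Y t \<omega>"
    by (intro tendsto_intros)
  then show ?thesis
    unfolding path_of_def future_def by (simp add: dyadic_above_in_dyadics limI)
qed

definition tail_integral :: "(real \<Rightarrow> ennreal) \<Rightarrow> real \<Rightarrow> real \<Rightarrow> 'a \<Rightarrow> ennreal" where
  "tail_integral g x t \<omega> = (\<integral>\<^sup>+ s\<in>{t..}. g (x + Y s \<omega>) \<partial>lborel)"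

text \<open>
  Truncation at \<open>0\<close> extends the process to negative times in a jointly measurable way, by means of
  the reconstruction of the path from its dyadic values.
\<close>
lemma measurable_Y_joint[measurable]:
  "(\<lambda>(s, \<omega>). Y (max 0 s) \<omega>) \<in> borel_measurable (borel \<Otimes>\<^sub>M M)"
proof -
  have "(\<lambda>(s, \<omega>). path_of (future 0 \<omega>) (max 0 s) + Y 0 \<omega>) \<in> borel_measurable (borel \<Otimes>\<^sub>M M)"
    by measurable
  then show ?thesis
    by (rule measurable_cong[THEN iffD1, rotated]) (auto simp: space_pair_measure path_of_future)
qed

lemma measurable_section:
  assumes "\<omega> \<in> space M"
  shows "(\<lambda>s. Y (max 0 s) \<omega>) \<in> borel_measurable borel"
  using measurable_compose[OF measurable_Pair2'[OF assms, of borel] measurable_Y_joint] by simp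

lemma tail_integral_eq_max:
  assumes "0 \<le> t"
  shows "tail_integral g x t \<omega> = (\<integral>\<^sup>+ s\<in>{t..}. g (x + Y (max 0 s) \<omega>) \<partial>lborel)"
  unfolding tail_integral_def using assms by (intro nn_integral_cong) (auto simp: indicator_def)

lemma tail_integral_eq_path_integral:
  assumes [measurable]: "g \<in> borel_measurable borel" and \<omega>: "\<omega> \<in> space M" and t: "0 \<le> t"
  shows "tail_integral g x t \<omega> = path_integral g (x + Y t \<omega>) (future t \<omega>)"
proof -
  note measurable_section[OF \<omega>, measurable]
  have "tail_integral g x t \<omega> = (\<integral>\<^sup>+ s. g (x + Y (max 0 s) \<omega>) * indicator {t..} s \<partial>lborel)"
    using t by (rule tail_integral_eq_max)
  also have "\<dots> = (\<integral>\<^sup>+ s. g (x + Y (max 0 (t + 1 * s)) \<omega>) * indicator {t..} (t + 1 * s) \<partial>lborel)"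
    by (subst nn_integral_real_affine[of _ 1 t]) auto
  also have "\<dots> = path_integral g (x + Y t \<omega>) (future t \<omega>)"
    unfolding path_integral_def
    by (intro nn_integral_cong) (use t in \<open>auto simp: indicator_def path_of_future[OF \<omega>]\<close>)
  finally show ?thesis .
qed

lemma measurable_tail_integral[measurable]:
  assumes [measurable]: "g \<in> borel_measurable borel" and "0 \<le> t"
  shows "tail_integral g x t \<in> borel_measurable M"
proof -
  have "(\<lambda>\<omega>. path_integral g (x + Y t \<omega>) (future t \<omega>)) \<in> borel_measurable M" by measurable
  then show ?thesis
    by (rule measurable_cong[THEN iffD1, rotated]) (simp add: tail_integral_eq_path_integral assms)
qed

lemma increments_law_stationary:
  assumes "0 \<le> t" "0 \<le> h"
  shows "distr M (PiM {..<Suc L} (\<lambda>_. borel)) (\<lambda>\<omega>. \<lambda>i\<in>{..<Suc L}. Y (t + real (Suc i) * h) \<omega> - Y (t + real i * h) \<omega>) =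
    PiM {..<Suc L} (\<lambda>_. distr M borel (Y h))"
proof -
  have "indep_vars (\<lambda>_. borel) (\<lambda>i \<omega>. Y (t + real (Suc i) * h) \<omega> - Y (t + real i * h) \<omega>) {..<Suc L}"
    using independent_increments[of "\<lambda>i. t + real i * h" "Suc L"] assms by (simp add: mult_right_mono)
  then have "distr M (PiM {..<Suc L} (\<lambda>_. borel)) (\<lambda>\<omega>. \<lambda>i\<in>{..<Suc L}. Y (t + real (Suc i) * h) \<omega> - Y (t + real i * h) \<omega>) =
      PiM {..<Suc L} (\<lambda>i. distr M borel (\<lambda>\<omega>. Y (t + real (Suc i) * h) \<omega> - Y (t + real i * h) \<omega>))"
    by (subst (asm) indep_vars_iff_distr_eq_PiM) auto
  also have "\<dots> = PiM {..<Suc L} (\<lambda>_. distr M borel (Y h))"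
  proof (rule PiM_cong)
    fix i :: nat
    have "distr M borel (\<lambda>\<omega>. Y ((t + real i * h) + h) \<omega> - Y (t + real i * h) \<omega>) = distr M borel (Y h)"
      using assms by (intro stationary_increments) auto
    then show "distr M borel (\<lambda>\<omega>. Y (t + real (Suc i) * h) \<omega> - Y (t + real i * h) \<omega>) = distr M borel (Y h)"
      by (simp add: algebra_simps)
  qed simp
  finally show ?thesis .
qed

lemma increment_eq_sum:
  "Y (t + real k * h) \<omega> - Y t \<omega> = (\<Sum>i<k. Y (t + real (Suc i) * h) \<omega> - Y (t + real i * h) \<omega>)"
  using sum_lessThan_telescope[of "\<lambda>i. Y (t + real i * h) \<omega>" k] by simp

text \<open>
  Finitely many dyadic time distances have a common denominator, so the increments in question are
  partial sums of increments along an equidistant grid. Those are independent with a common law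
  that does not depend on the starting time \<open>t\<close>.
\<close>
lemma future_fdd_stationary:
  assumes "0 \<le> t" "finite J" "J \<subseteq> dyadics" and A: "\<And>q. q \<in> J \<Longrightarrow> A q \<in> sets borel"
  shows "prob {\<omega>\<in>space M. \<forall>q\<in>J. Y (t + q) \<omega> - Y t \<omega> \<in> A q} =
    prob {\<omega>\<in>space M. \<forall>q\<in>J. Y (0 + q) \<omega> - Y 0 \<omega> \<in> A q}"
proof -
  obtain m :: nat and k :: "real \<Rightarrow> nat" where k: "\<And>q. q \<in> J \<Longrightarrow> q = real (k q) / 2 ^ m"
    using finite_dyadics_common_denominator[OF assms(2,3)] by blast
  define h :: real where "h = 1 / 2 ^ m"
  define L where "L = Max (insert 0 (k ` J))"
  have L: "k q \<le> L" if "q \<in> J" for q unfolding L_def using that assms(2) by (intro Max_ge) auto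
  define N where "N = PiM {..<Suc L} (\<lambda>_. borel :: real measure)"
  define Q where "Q = {z\<in>space N. \<forall>q\<in>J. (\<Sum>i<k q. z i) \<in> A q}"
  have Q[measurable]: "Q \<in> sets N"
    unfolding Q_def
  proof (rule sets.sets_Collect_finite_All[OF _ assms(2)])
    fix q assume q: "q \<in> J"
    have "(\<lambda>z. \<Sum>i<k q. z i) \<in> borel_measurable N"
      unfolding N_def using L[OF q] by (intro borel_measurable_sum measurable_component_singleton) auto
    then show "{z\<in>space N. (\<Sum>i<k q. z i) \<in> A q} \<in> sets N"
      using measurable_sets[OF _ A[OF q]] by (simp add: vimage_def Int_def conj_commute)
  qed
  have *: "prob {\<omega>\<in>space M. \<forall>q\<in>J. Y (t + q) \<omega> - Y t \<omega> \<in> A q} =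
      measure (PiM {..<Suc L} (\<lambda>_. distr M borel (Y h))) Q" if "0 \<le> t" for t
  proof -
    define Z where "Z = (\<lambda>\<omega>. \<lambda>i\<in>{..<Suc L}. Y (t + real (Suc i) * h) \<omega> - Y (t + real i * h) \<omega>)"
    have Z[measurable]: "Z \<in> measurable M N" unfolding Z_def N_def by measurable
    have "Y (t + q) \<omega> - Y t \<omega> = (\<Sum>i<k q. Z \<omega> i)" if "q \<in> J" for q \<omega>
    proof -
      have "q = real (k q) * h" using k[OF that] by (simp add: h_def)
      then have "Y (t + q) \<omega> - Y t \<omega> = Y (t + real (k q) * h) \<omega> - Y t \<omega>" by simp
      also have "\<dots> = (\<Sum>i<k q. Z \<omega> i)"
        unfolding increment_eq_sum Z_def using L[OF that] by (intro sum.cong) auto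
      finally show ?thesis .
    qed
    then have "{\<omega>\<in>space M. \<forall>q\<in>J. Y (t + q) \<omega> - Y t \<omega> \<in> A q} = Z -` Q \<inter> space M"
      using measurable_space[OF Z] by (auto simp: Q_def)
    then have "prob {\<omega>\<in>space M. \<forall>q\<in>J. Y (t + q) \<omega> - Y t \<omega> \<in> A q} = measure (distr M N Z) Q"
      by (simp add: measure_distr)
    then show ?thesis unfolding N_def Z_def
      by (subst (asm) increments_law_stationary) (use that in \<open>auto simp: h_def\<close>)
  qed
  show ?thesis using *[OF assms(1)] *[of 0] by simp
qed

text \<open>
  The times \<open>t 0, \<dots>, t K\<close> are continued by an equidistant dyadic grid. The past is a function of
  the first \<open>K\<close> increments along the combined sequence and the future increments are partial sums of
  the remaining ones.
\<close>
lemma past_future_fdd_independent: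
  assumes t0: "t 0 = 0" and mono: "\<And>i. t i \<le> t (Suc i)" and C: "C \<in> sets (PiM {..K} (\<lambda>_. borel :: real measure))"
    and J: "finite J" "J \<subseteq> dyadics" and A: "\<And>q. q \<in> J \<Longrightarrow> A q \<in> sets borel"
  shows "prob {\<omega>\<in>space M. (\<lambda>i\<in>{..K}. Y (t i) \<omega>) \<in> C \<and> (\<forall>q\<in>J. Y (t K + q) \<omega> - Y (t K) \<omega> \<in> A q)} =
    prob {\<omega>\<in>space M. (\<lambda>i\<in>{..K}. Y (t i) \<omega>) \<in> C} * prob {\<omega>\<in>space M. \<forall>q\<in>J. Y (t K + q) \<omega> - Y (t K) \<omega> \<in> A q}"
proof -
  obtain m :: nat and k :: "real \<Rightarrow> nat" where k: "\<And>q. q \<in> J \<Longrightarrow> q = real (k q) / 2 ^ m"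
    using finite_dyadics_common_denominator[OF J] by blast
  define h :: real where "h = 1 / 2 ^ m"
  define L where "L = Max (insert 0 (k ` J))"
  have L: "k q \<le> L" if "q \<in> J" for q unfolding L_def using that J(1) by (intro Max_ge) auto
  define r where "r i = (if i \<le> K then t i else t K + real (i - K) * h)" for i
  have r_K: "r (K + i) = t K + real i * h" for i by (simp add: r_def)
  have r_mono: "r i \<le> r (Suc i)" for i
  proof -
    consider "Suc i \<le> K" | "K \<le> i" by linarith
    then show ?thesis
    proof cases
      case 2
      then obtain j where "i = K + j" by (auto simp: le_iff_add)
      then show ?thesis using r_K[of j] r_K[of "Suc j"] by (simp add: h_def divide_right_mono)
    qed (simp add: r_def mono)
  qed
  define X where "X i \<omega> = Y (r (Suc i)) \<omega> - Y (r i) \<omega>" for i \<omega>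
  have [measurable]: "X i \<in> borel_measurable M" for i unfolding X_def by measurable
  define NA where "NA = PiM {..<K} (\<lambda>_. borel :: real measure)"
  define NB where "NB = PiM {K..<K + L} (\<lambda>_. borel :: real measure)"
  have "indep_vars (\<lambda>_. borel) X {..<K + L}"
    unfolding X_def by (rule independent_increments) (use t0 r_mono in \<open>auto simp: r_def\<close>)
  then have ind: "indep_var NA (\<lambda>\<omega>. restrict (\<lambda>i. X i \<omega>) {..<K}) NB (\<lambda>\<omega>. restrict (\<lambda>i. X i \<omega>) {K..<K + L})"
    unfolding NA_def NB_def by (rule indep_var_restrict) auto
  define G where "G z = (\<lambda>i\<in>{..K}. \<Sum>j<i. z j)" for z :: "nat \<Rightarrow> real"
  have G: "G \<in> measurable NA (PiM {..K} (\<lambda>_. borel))"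
    unfolding G_def NA_def
    by (intro measurable_restrict borel_measurable_sum measurable_component_singleton) auto
  define CA where "CA = G -` C \<inter> space NA"
  have CA: "CA \<in> sets NA" unfolding CA_def using G C by (rule measurable_sets)
  define CB where "CB = {z\<in>space NB. \<forall>q\<in>J. (\<Sum>i<k q. z (K + i)) \<in> A q}"
  have CB: "CB \<in> sets NB"
    unfolding CB_def
  proof (rule sets.sets_Collect_finite_All[OF _ J(1)])
    fix q assume q: "q \<in> J"
    have "(\<lambda>z. \<Sum>i<k q. z (K + i)) \<in> borel_measurable NB"
      unfolding NB_def using L[OF q] by (intro borel_measurable_sum measurable_component_singleton) auto
    then show "{z\<in>space NB. (\<Sum>i<k q. z (K + i)) \<in> A q} \<in> sets NB"
      using measurable_sets[OF _ A[OF q]] by (simp add: vimage_def Int_def conj_commute)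
  qed
  have past: "(\<lambda>i\<in>{..K}. Y (t i) \<omega>) = G (restrict (\<lambda>i. X i \<omega>) {..<K})" if "\<omega> \<in> space M" for \<omega>
  proof -
    have "Y (t i) \<omega> = (\<Sum>j<i. restrict (\<lambda>i. X i \<omega>) {..<K} j)" if "i \<le> K" for i
    proof -
      have "(\<Sum>j<i. restrict (\<lambda>i. X i \<omega>) {..<K} j) = (\<Sum>j<i. Y (r (Suc j)) \<omega> - Y (r j) \<omega>)"
        using that by (intro sum.cong) (auto simp: X_def)
      also have "\<dots> = Y (r i) \<omega> - Y (r 0) \<omega>" by (rule sum_lessThan_telescope)
      finally show ?thesis using that t0 start[OF \<open>\<omega> \<in> space M\<close>] by (simp add: r_def)
    qed
    then show ?thesis by (auto simp: G_def)
  qed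
  have fut: "Y (t K + q) \<omega> - Y (t K) \<omega> = (\<Sum>i<k q. restrict (\<lambda>i. X i \<omega>) {K..<K + L} (K + i))" if "q \<in> J" for q \<omega>
  proof -
    have "q = real (k q) * h" using k[OF that] by (simp add: h_def)
    then have "Y (t K + q) \<omega> - Y (t K) \<omega> = Y (t K + real (k q) * h) \<omega> - Y (t K) \<omega>" by simp
    also have "\<dots> = (\<Sum>i<k q. restrict (\<lambda>i. X i \<omega>) {K..<K + L} (K + i))"
      unfolding increment_eq_sum using L[OF that] r_K[of "Suc _"]
      by (intro sum.cong) (auto simp: X_def r_K simp del: of_nat_Suc)
    finally show ?thesis .
  qed
  have eqA: "{\<omega>\<in>space M. (\<lambda>i\<in>{..K}. Y (t i) \<omega>) \<in> C} = (\<lambda>\<omega>. restrict (\<lambda>i. X i \<omega>) {..<K}) -` CA \<inter> space M"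
    using past by (auto simp: CA_def NA_def space_PiM)
  have eqB: "{\<omega>\<in>space M. \<forall>q\<in>J. Y (t K + q) \<omega> - Y (t K) \<omega> \<in> A q} = (\<lambda>\<omega>. restrict (\<lambda>i. X i \<omega>) {K..<K + L}) -` CB \<inter> space M"
    unfolding CB_def NB_def by (simp add: fut space_PiM) auto
  have "{\<omega>\<in>space M. (\<lambda>i\<in>{..K}. Y (t i) \<omega>) \<in> C \<and> (\<forall>q\<in>J. Y (t K + q) \<omega> - Y (t K) \<omega> \<in> A q)} =
    {\<omega>\<in>space M. (\<lambda>i\<in>{..K}. Y (t i) \<omega>) \<in> C} \<inter> {\<omega>\<in>space M. \<forall>q\<in>J. Y (t K + q) \<omega> - Y (t K) \<omega> \<in> A q}"
    by auto
  also have "\<dots> = (\<lambda>\<omega>. (restrict (\<lambda>i. X i \<omega>) {..<K}, restrict (\<lambda>i. X i \<omega>) {K..<K + L})) -` (CA \<times> CB) \<inter> space M"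
    unfolding eqA eqB by auto
  finally show ?thesis
    unfolding eqA eqB using indep_varD[OF ind CA CB] by simp
qed

text \<open>
  The Markov property in law: past and future are independent and the future has the law of the
  process itself. Measures on the countable product \<open>path_space\<close> are determined by their
  finite-dimensional marginals.
\<close>
lemma distr_past_future:
  assumes t0: "t 0 = 0" and mono: "\<And>i. t i \<le> t (Suc i)"
  shows "distr M (PiM {..K} (\<lambda>_. borel) \<Otimes>\<^sub>M path_space) (\<lambda>\<omega>. (\<lambda>i\<in>{..K}. Y (t i) \<omega>, future (t K) \<omega>)) =
    distr M (PiM {..K} (\<lambda>_. borel)) (\<lambda>\<omega>. \<lambda>i\<in>{..K}. Y (t i) \<omega>) \<Otimes>\<^sub>M path_law"
proof -
  let ?S = "PiM {..K} (\<lambda>_. borel :: real measure)"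
  let ?past = "\<lambda>\<omega>. \<lambda>i\<in>{..K}. Y (t i) \<omega>"
  have tK: "0 \<le> t K" using lift_Suc_mono_le[of t 0 K] mono t0 by simp
  have past[measurable]: "?past \<in> measurable M ?S" by measurable
  interpret P: prob_space "distr M ?S ?past" by (rule prob_space_distr) measurable
  interpret L: prob_space path_law by (rule prob_space_path_law)
  have "distr M ?S ?past \<Otimes>\<^sub>M path_law = distr M (?S \<Otimes>\<^sub>M path_space) (\<lambda>\<omega>. (?past \<omega>, future (t K) \<omega>))"
  proof (rule pair_measure_eqI)
    show "sigma_finite_measure (distr M ?S ?past)" "sigma_finite_measure path_law" by unfold_locales
    show "sets (distr M ?S ?past \<Otimes>\<^sub>M path_law) = sets (distr M (?S \<Otimes>\<^sub>M path_space) (\<lambda>\<omega>. (?past \<omega>, future (t K) \<omega>)))"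
      by (simp cong: sets_pair_measure_cong)
    fix C D assume C: "C \<in> sets (distr M ?S ?past)" and D: "D \<in> sets path_law"
    then have [measurable]: "C \<in> sets ?S" "D \<in> sets path_space" by auto
    define H where "H = ?past -` C \<inter> space M"
    have [measurable]: "H \<in> sets M" unfolding H_def by measurable
    define P where "P = distr (density M (indicator H)) path_space (future (t K))"
    define Q where "Q = scale_measure (emeasure M H) path_law"
    have P: "emeasure P D = emeasure M (H \<inter> (future (t K) -` D \<inter> space M))" if [measurable]: "D \<in> sets path_space" for D
      unfolding P_def by (subst emeasure_distr) (auto simp: emeasure_restricted)
    have "P = Q"
    proof (rule measure_eqI_PiM_infinite[where I = dyadics and M = "\<lambda>_. borel"])
      show "sets P = sets (PiM dyadics (\<lambda>_. borel))" "sets Q = sets (PiM dyadics (\<lambda>_. borel))"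
        by (simp_all add: P_def Q_def path_space_def[symmetric])
      show "finite_measure P"
      proof
        have "space P = space path_space" by (simp add: P_def)
        then show "emeasure P (space P) \<noteq> \<infinity>" by (simp add: P)
      qed
      fix A J assume J: "finite J" "J \<subseteq> dyadics" and A: "\<And>i. i \<in> J \<Longrightarrow> A i \<in> sets (borel :: real measure)"
      define D where "D = prod_emb dyadics (\<lambda>_. borel :: real measure) J (Pi\<^sub>E J A)"
      have D[measurable]: "D \<in> sets path_space"
        unfolding D_def path_space_def using J A by (intro sets_PiM_I) auto
      have fD: "future s -` D \<inter> space M = {\<omega>\<in>space M. \<forall>q\<in>J. Y (s + q) \<omega> - Y s \<omega> \<in> A q}" for s
      proof -
        have "future s \<omega> \<in> D \<longleftrightarrow> (\<forall>q\<in>J. Y (s + q) \<omega> - Y s \<omega> \<in> A q)" for \<omega>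
        proof -
          have "restrict (future s \<omega>) J \<in> Pi\<^sub>E J A \<longleftrightarrow> (\<forall>q\<in>J. Y (s + q) \<omega> - Y s \<omega> \<in> A q)"
            using J(2) by (auto simp: future_def PiE_iff subset_iff)
          then show ?thesis unfolding D_def prod_emb_def by (auto simp: future_def PiE_iff)
        qed
        then show ?thesis by auto
      qed
      have "emeasure P D = prob {\<omega>\<in>space M. ?past \<omega> \<in> C \<and> (\<forall>q\<in>J. Y (t K + q) \<omega> - Y (t K) \<omega> \<in> A q)}"
        unfolding P[OF D] fD H_def emeasure_eq_measure by (intro arg_cong[where f = "\<lambda>x. ennreal (prob x)"]) auto
      also have "\<dots> = prob {\<omega>\<in>space M. ?past \<omega> \<in> C} * prob {\<omega>\<in>space M. \<forall>q\<in>J. Y (t K + q) \<omega> - Y (t K) \<omega> \<in> A q}"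
        using past_future_fdd_independent[OF t0 mono _ J, of C K A] A by simp
      also have "prob {\<omega>\<in>space M. \<forall>q\<in>J. Y (t K + q) \<omega> - Y (t K) \<omega> \<in> A q} =
          prob {\<omega>\<in>space M. \<forall>q\<in>J. Y (0 + q) \<omega> - Y 0 \<omega> \<in> A q}"
        using tK J A by (rule future_fdd_stationary)
      also have "{\<omega>\<in>space M. ?past \<omega> \<in> C} = H" by (auto simp: H_def)
      also have "ennreal (prob H * prob {\<omega>\<in>space M. \<forall>q\<in>J. Y (0 + q) \<omega> - Y 0 \<omega> \<in> A q}) = emeasure Q D"
        unfolding Q_def path_law_def fD[symmetric]
        by (simp add: emeasure_distr emeasure_eq_measure ennreal_mult)
      finally show "emeasure P (prod_emb dyadics (\<lambda>_. borel) J (Pi\<^sub>E J A)) = emeasure Q (prod_emb dyadics (\<lambda>_. borel) J (Pi\<^sub>E J A))"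
        by (simp add: D_def)
    qed
    then have "emeasure P D = emeasure Q D" by simp
    then have "emeasure M H * emeasure path_law D = emeasure M (H \<inter> (future (t K) -` D \<inter> space M))"
      by (simp add: P Q_def)
    also have "H \<inter> (future (t K) -` D \<inter> space M) = (\<lambda>\<omega>. (?past \<omega>, future (t K) \<omega>)) -` (C \<times> D) \<inter> space M"
      by (auto simp: H_def)
    finally show "emeasure (distr M ?S ?past) C * emeasure path_law D =
        emeasure (distr M (?S \<Otimes>\<^sub>M path_space) (\<lambda>\<omega>. (?past \<omega>, future (t K) \<omega>))) (C \<times> D)"
      by (simp add: emeasure_distr H_def)
  qed
  then show ?thesis by simp
qed

theorem markov_property:
  assumes t0: "t 0 = 0" and mono: "\<And>i. t i \<le> t (Suc i)"
    and F[measurable]: "F \<in> borel_measurable (PiM {..K} (\<lambda>_. borel) \<Otimes>\<^sub>M path_space)"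
  shows "(\<integral>\<^sup>+ \<omega>. F (\<lambda>i\<in>{..K}. Y (t i) \<omega>, future (t K) \<omega>) \<partial>M) =
    (\<integral>\<^sup>+ \<omega>. (\<integral>\<^sup>+ w. F (\<lambda>i\<in>{..K}. Y (t i) \<omega>, w) \<partial>path_law) \<partial>M)"
proof -
  let ?S = "PiM {..K} (\<lambda>_. borel :: real measure)"
  let ?past = "\<lambda>\<omega>. \<lambda>i\<in>{..K}. Y (t i) \<omega>"
  have past[measurable]: "?past \<in> measurable M ?S" by measurable
  interpret L: prob_space path_law by (rule prob_space_path_law)
  have "(\<integral>\<^sup>+ \<omega>. F (?past \<omega>, future (t K) \<omega>) \<partial>M) =
      (\<integral>\<^sup>+ x. F x \<partial>distr M (?S \<Otimes>\<^sub>M path_space) (\<lambda>\<omega>. (?past \<omega>, future (t K) \<omega>)))"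
    by (subst nn_integral_distr) auto
  also have "\<dots> = (\<integral>\<^sup>+ x. F x \<partial>(distr M ?S ?past \<Otimes>\<^sub>M path_law))"
    by (simp only: distr_past_future[OF t0 mono])
  also have "\<dots> = (\<integral>\<^sup>+ p. (\<integral>\<^sup>+ w. F (p, w) \<partial>path_law) \<partial>distr M ?S ?past)"
    by (rule L.nn_integral_fst[symmetric]) measurable
  also have "\<dots> = (\<integral>\<^sup>+ \<omega>. (\<integral>\<^sup>+ w. F (?past \<omega>, w) \<partial>path_law) \<partial>M)"
    by (rule nn_integral_distr) measurable
  finally show ?thesis .
qed


section \<open>Perpetual integrals and their laws\<close>

text \<open>
  The probability that the perpetual integral started at \<open>y\<close> lies in \<open>B\<close>, see
  \<open>perpetual_prob_eq\<close>. Defining it on path space makes it visibly measurable in \<open>y\<close>.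
\<close>
definition perpetual_prob :: "(real \<Rightarrow> ennreal) \<Rightarrow> ennreal set \<Rightarrow> real \<Rightarrow> ennreal" where
  "perpetual_prob g B y = (\<integral>\<^sup>+ w. indicator B (path_integral g y w) \<partial>path_law)"

lemma measurable_perpetual_prob[measurable]:
  assumes [measurable]: "g \<in> borel_measurable borel" "B \<in> sets borel"
  shows "perpetual_prob g B \<in> borel_measurable borel"
proof -
  interpret L: prob_space path_law by (rule prob_space_path_law)
  show ?thesis unfolding perpetual_prob_def by measurable
qed

lemma markov_tail_integral:
  assumes t0: "t 0 = 0" and mono: "\<And>i. t i \<le> t (Suc i)"
    and [measurable]: "g \<in> borel_measurable borel" "B \<in> sets borel"
    and H[measurable]: "H \<in> borel_measurable (PiM {..K} (\<lambda>_. borel))"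
  shows "(\<integral>\<^sup>+ \<omega>. H (\<lambda>i\<in>{..K}. Y (t i) \<omega>) * indicator B (tail_integral g x (t K) \<omega>) \<partial>M) =
    (\<integral>\<^sup>+ \<omega>. H (\<lambda>i\<in>{..K}. Y (t i) \<omega>) * perpetual_prob g B (x + Y (t K) \<omega>) \<partial>M)"
proof -
  interpret L: prob_space path_law by (rule prob_space_path_law)
  have tK: "0 \<le> t K" using lift_Suc_mono_le[of t 0 K] mono t0 by simp
  define F where "F z = H (fst z) * indicator B (path_integral g (x + fst z K) (snd z))"
    for z :: "(nat \<Rightarrow> real) \<times> (real \<Rightarrow> real)"
  have [measurable]: "(\<lambda>z. fst z K) \<in> borel_measurable (PiM {..K} (\<lambda>_. borel :: real measure) \<Otimes>\<^sub>M path_space)"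
    by (intro measurable_compose[OF measurable_fst] measurable_component_singleton) simp
  have F[measurable]: "F \<in> borel_measurable (PiM {..K} (\<lambda>_. borel) \<Otimes>\<^sub>M path_space)"
    unfolding F_def by measurable
  have "(\<integral>\<^sup>+ \<omega>. H (\<lambda>i\<in>{..K}. Y (t i) \<omega>) * indicator B (tail_integral g x (t K) \<omega>) \<partial>M) =
      (\<integral>\<^sup>+ \<omega>. F (\<lambda>i\<in>{..K}. Y (t i) \<omega>, future (t K) \<omega>) \<partial>M)"
    by (intro nn_integral_cong) (simp add: F_def tail_integral_eq_path_integral tK)
  also have "\<dots> = (\<integral>\<^sup>+ \<omega>. (\<integral>\<^sup>+ w. F (\<lambda>i\<in>{..K}. Y (t i) \<omega>, w) \<partial>path_law) \<partial>M)"
    by (rule markov_property[OF t0 mono F])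
  also have "\<dots> = (\<integral>\<^sup>+ \<omega>. H (\<lambda>i\<in>{..K}. Y (t i) \<omega>) * perpetual_prob g B (x + Y (t K) \<omega>) \<partial>M)"
  proof (rule nn_integral_cong)
    fix \<omega> assume "\<omega> \<in> space M"
    have "(\<lambda>w. indicator B (path_integral g (x + Y (t K) \<omega>) w) :: ennreal) \<in> borel_measurable path_law"
      by measurable
    then show "(\<integral>\<^sup>+ w. F (\<lambda>i\<in>{..K}. Y (t i) \<omega>, w) \<partial>path_law) =
      H (\<lambda>i\<in>{..K}. Y (t i) \<omega>) * perpetual_prob g B (x + Y (t K) \<omega>)"
      unfolding F_def perpetual_prob_def by (simp add: nn_integral_cmult)
  qed
  finally show ?thesis .
qed

lemma markov_tail_integral_single:
  assumes s: "0 \<le> s" and [measurable]: "g \<in> borel_measurable borel" "B \<in> sets borel" "\<psi> \<in> borel_measurable borel"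
  shows "(\<integral>\<^sup>+ \<omega>. \<psi> (Y s \<omega>) * indicator B (tail_integral g x s \<omega>) \<partial>M) =
    (\<integral>\<^sup>+ \<omega>. \<psi> (Y s \<omega>) * perpetual_prob g B (x + Y s \<omega>) \<partial>M)"
proof -
  have "(\<lambda>z. \<psi> (z (1::nat))) \<in> borel_measurable (PiM {..1} (\<lambda>_. borel))"
    by (intro measurable_compose[OF measurable_component_singleton]) auto
  from markov_tail_integral[where t = "\<lambda>i. if i = 0 then 0 else s" and K = 1, OF _ _ _ _ this, of g B x]
  show ?thesis using s by simp
qed

lemma perpetual_prob_eq:
  assumes "g \<in> borel_measurable borel" "B \<in> sets borel"
  shows "perpetual_prob g B x = (\<integral>\<^sup>+ \<omega>. indicator B (tail_integral g x 0 \<omega>) \<partial>M)"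
proof -
  have "(\<integral>\<^sup>+ \<omega>. perpetual_prob g B (x + Y 0 \<omega>) \<partial>M) = (\<integral>\<^sup>+ \<omega>. perpetual_prob g B x \<partial>M)"
    by (intro nn_integral_cong) (simp add: start)
  then show ?thesis
    using markov_tail_integral_single[of 0 g B "\<lambda>_. 1" x] assms by (simp add: emeasure_space_1)
qed

lemma perpetual_prob_le_1: "perpetual_prob g B y \<le> 1"
proof -
  interpret L: prob_space path_law by (rule prob_space_path_law)
  have "perpetual_prob g B y \<le> (\<integral>\<^sup>+ w. 1 \<partial>path_law)"
    unfolding perpetual_prob_def by (intro nn_integral_mono) (simp add: indicator_def)
  then show ?thesis by (simp add: L.emeasure_space_1)
qed

lemma perpetual_prob_compl:
  assumes [measurable]: "g \<in> borel_measurable borel" "B \<in> sets borel"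
  shows "perpetual_prob g B y + perpetual_prob g (- B) y = 1"
proof -
  interpret L: prob_space path_law by (rule prob_space_path_law)
  have "perpetual_prob g B y + perpetual_prob g (- B) y =
      (\<integral>\<^sup>+ w. indicator B (path_integral g y w) + indicator (- B) (path_integral g y w) \<partial>path_law)"
    unfolding perpetual_prob_def by (rule nn_integral_add[symmetric]) measurable
  also have "\<dots> = (\<integral>\<^sup>+ w. 1 \<partial>path_law)" by (intro nn_integral_cong) (simp add: indicator_def)
  finally show ?thesis by (simp add: L.emeasure_space_1)
qed

lemma tail_integral_antimono: "s \<le> t \<Longrightarrow> tail_integral g x t \<omega> \<le> tail_integral g x s \<omega>"
  unfolding tail_integral_def by (intro nn_integral_mono) (auto simp: indicator_def)

lemma tail_integral_split:
  assumes "g \<in> borel_measurable borel" "\<omega> \<in> space M" "0 \<le> t"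
  shows "tail_integral g x 0 \<omega> \<le> (\<integral>\<^sup>+ s\<in>{0..t}. g (x + Y s \<omega>) \<partial>lborel) + tail_integral g x t \<omega>"
proof -
  note [measurable] = assms(1) measurable_section[OF assms(2)]
  have "tail_integral g x 0 \<omega> \<le>
      (\<integral>\<^sup>+ s. g (x + Y (max 0 s) \<omega>) * indicator {0..t} s + g (x + Y (max 0 s) \<omega>) * indicator {t..} s \<partial>lborel)"
    unfolding tail_integral_def by (intro nn_integral_mono) (auto simp: indicator_def)
  also have "\<dots> = (\<integral>\<^sup>+ s. g (x + Y (max 0 s) \<omega>) * indicator {0..t} s \<partial>lborel) +
      (\<integral>\<^sup>+ s. g (x + Y (max 0 s) \<omega>) * indicator {t..} s \<partial>lborel)"
    by (rule nn_integral_add) measurable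
  also have "(\<integral>\<^sup>+ s. g (x + Y (max 0 s) \<omega>) * indicator {0..t} s \<partial>lborel) = (\<integral>\<^sup>+ s\<in>{0..t}. g (x + Y s \<omega>) \<partial>lborel)"
    by (intro nn_integral_cong) (auto simp: indicator_def)
  finally show ?thesis using tail_integral_eq_max[OF assms(3)] by simp
qed

definition locally_finite :: "(real \<Rightarrow> ennreal) \<Rightarrow> bool" where
  "locally_finite g \<longleftrightarrow> (\<forall>x. AE \<omega> in M. \<forall>t>0. (\<integral>\<^sup>+ s\<in>{0..t}. g (x + Y s \<omega>) \<partial>lborel) < \<infinity>)"

lemma tail_integral_finite_iff:
  assumes "g \<in> borel_measurable borel" "locally_finite g" "0 \<le> t"
  shows "AE \<omega> in M. tail_integral g x t \<omega> < \<infinity> \<longleftrightarrow> tail_integral g x 0 \<omega> < \<infinity>"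
proof -
  have "AE \<omega> in M. \<forall>t>0. (\<integral>\<^sup>+ s\<in>{0..t}. g (x + Y s \<omega>) \<partial>lborel) < \<infinity>"
    using assms(2) by (simp add: locally_finite_def)
  then show ?thesis
  proof (rule AE_mp, intro AE_I2 impI)
    fix \<omega> assume \<omega>: "\<omega> \<in> space M" and fin: "\<forall>t>0. (\<integral>\<^sup>+ s\<in>{0..t}. g (x + Y s \<omega>) \<partial>lborel) < \<infinity>"
    show "tail_integral g x t \<omega> < \<infinity> \<longleftrightarrow> tail_integral g x 0 \<omega> < \<infinity>"
    proof
      assume "tail_integral g x 0 \<omega> < \<infinity>"
      then show "tail_integral g x t \<omega> < \<infinity>"
        using tail_integral_antimono[OF assms(3)] by (rule le_less_trans[rotated])
    next
      assume *: "tail_integral g x t \<omega> < \<infinity>"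
      show "tail_integral g x 0 \<omega> < \<infinity>"
      proof (cases "t = 0")
        case False
        then have "(\<integral>\<^sup>+ s\<in>{0..t}. g (x + Y s \<omega>) \<partial>lborel) < \<infinity>" using fin assms(3) by simp
        then have "(\<integral>\<^sup>+ s\<in>{0..t}. g (x + Y s \<omega>) \<partial>lborel) + tail_integral g x t \<omega> < \<infinity>" using * by simp
        then show ?thesis using tail_integral_split[OF assms(1) \<omega> assms(3)] by (rule le_less_trans[rotated])
      qed (use * in simp)
    qed
  qed
qed

text \<open>
  Since bounded time intervals contribute a finite amount, finiteness of the perpetual integral
  is decided after time \<open>s\<close>. So its probability is a harmonic function of the starting point for
  convolution with the law of \<open>Y s\<close>.
\<close>
lemma finiteness_prob_AE_const:
  assumes [measurable]: "g \<in> borel_measurable borel" and fin: "locally_finite g" and s: "0 \<le> s"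
  shows "AE \<omega> in M. perpetual_prob g {..<\<infinity>} (x + Y s \<omega>) = perpetual_prob g {..<\<infinity>} x"
proof -
  define u where "u y = enn2real (perpetual_prob g {..<\<infinity>} y)" for y
  have p: "perpetual_prob g {..<\<infinity>} y = ennreal (u y)" for y
    unfolding u_def using perpetual_prob_le_1[of g "{..<\<infinity>}" y]
    by (intro ennreal_enn2real[symmetric]) (auto intro: le_less_trans)
  have u_bd: "0 \<le> u y" "u y \<le> 1" for y
    using perpetual_prob_le_1[of g "{..<\<infinity>}" y] by (auto simp: u_def p[unfolded u_def] intro: enn2real_leI)
  have [measurable]: "u \<in> borel_measurable borel" unfolding u_def by measurable
  let ?\<mu> = "distr M borel (Y s)"
  have harm: "u y = (\<integral>z. u (y + z) \<partial>?\<mu>)" for y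
  proof -
    have int: "integrable M (\<lambda>\<omega>. u (y + Y s \<omega>))"
      by (rule integrable_const_bound[where B = 1]) (use u_bd in auto)
    have "ennreal (u y) = (\<integral>\<^sup>+ \<omega>. indicator {..<\<infinity>} (tail_integral g y 0 \<omega>) \<partial>M)"
      unfolding p[symmetric] by (rule perpetual_prob_eq) auto
    also have "\<dots> = (\<integral>\<^sup>+ \<omega>. 1 * indicator {..<\<infinity>} (tail_integral g y s \<omega>) \<partial>M)"
    proof (rule nn_integral_cong_AE)
      show "AE \<omega> in M. indicator {..<\<infinity>} (tail_integral g y 0 \<omega>) = (1 * indicator {..<\<infinity>} (tail_integral g y s \<omega>) :: ennreal)"
        using tail_integral_finite_iff[OF _ fin s, of y] by (auto simp: indicator_def elim!: eventually_mono)
    qed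
    also have "\<dots> = (\<integral>\<^sup>+ \<omega>. ennreal (u (y + Y s \<omega>)) \<partial>M)"
      unfolding p[symmetric] using markov_tail_integral_single[OF s, of g "{..<\<infinity>}" "\<lambda>_. 1" y] by simp
    also have "\<dots> = ennreal (\<integral>\<omega>. u (y + Y s \<omega>) \<partial>M)"
      using int u_bd by (intro nn_integral_eq_integral) auto
    also have "(\<integral>\<omega>. u (y + Y s \<omega>) \<partial>M) = (\<integral>z. u (y + z) \<partial>?\<mu>)"
      by (rule integral_distr[symmetric]) auto
    finally show ?thesis using u_bd by (simp add: ennreal_inj)
  qed
  have "AE z in ?\<mu>. u (x + z) = u x"
  proof (rule bounded_convolution_harmonic_AE_const)
    show "prob_space ?\<mu>" by (rule prob_space_distr) simp
    show "u y = (\<integral>z. u (y + z) \<partial>?\<mu>)" for y by (rule harm)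
  qed (simp_all add: u_bd)
  then have "AE \<omega> in M. u (x + Y s \<omega>) = u x" by (subst (asm) AE_distr_iff) auto
  then show ?thesis unfolding p by (rule eventually_mono) simp
qed

section \<open>Transience of the exceptional set\<close>

text \<open>
  Decompose according to the first grid time \<open>t i \<ge> T\<close> at which \<open>U\<close> is visited. Given this event
  \<open>C i\<close>, the perpetual integral is finite with probability exactly \<open>p\<close>, and the integral after
  \<open>t i\<close> is at most \<open>1\<close> with probability at most \<open>p / 2\<close>. So with probability at least \<open>p / 2\<close> the
  integral is finite but exceeds \<open>1\<close> after \<open>t i\<close>, and hence after \<open>T\<close>.
\<close>
lemma hitting_prob_grid:
  assumes t0: "t 0 = 0" and mono: "\<And>i. t i \<le> t (Suc i)" and T: "0 \<le> T"
    and g[measurable]: "g \<in> borel_measurable borel" and fin: "locally_finite g"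
    and p: "perpetual_prob g {..<\<infinity>} x = ennreal p" "0 < p"
    and O[measurable]: "U \<in> sets borel" and small: "\<And>y. y \<in> U \<Longrightarrow> perpetual_prob g {..1} y \<le> ennreal (p / 2)"
  shows "prob {\<omega>\<in>space M. \<exists>i\<le>K. T \<le> t i \<and> x + Y (t i) \<omega> \<in> U} \<le>
    2 / p * prob {\<omega>\<in>space M. tail_integral g x 0 \<omega> < \<infinity> \<and> 1 < tail_integral g x T \<omega>}"
proof -
  have t_nn: "0 \<le> t i" for i using lift_Suc_mono_le[of t 0 i] mono t0 by simp
  define hit where "hit i \<omega> \<longleftrightarrow> T \<le> t i \<and> x + Y (t i) \<omega> \<in> U" for i \<omega>
  have [measurable]: "Measurable.pred M (hit i)" for i unfolding hit_def by measurable
  define C where "C i = {\<omega>\<in>space M. hit i \<omega> \<and> (\<forall>j<i. \<not> hit j \<omega>)}" for i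
  have [measurable]: "C i \<in> sets M" for i unfolding C_def by measurable
  define F where "F = {\<omega>\<in>space M. tail_integral g x 0 \<omega> < \<infinity> \<and> 1 < tail_integral g x T \<omega>}"
  note [measurable] = measurable_tail_integral[OF g T, of x] measurable_tail_integral[OF g t_nn, of x]
    measurable_tail_integral[OF g, of 0 x, simplified]
  have [measurable]: "F \<in> sets M" unfolding F_def by measurable
  have C_markov: "emeasure M {\<omega>\<in>C i. tail_integral g x (t i) \<omega> \<in> B} = (\<integral>\<^sup>+ \<omega>. indicator (C i) \<omega> * perpetual_prob g B (x + Y (t i) \<omega>) \<partial>M)"
    if [measurable]: "B \<in> sets borel" for i B
  proof -
    define D where "D = {z\<in>space (PiM {..i} (\<lambda>_. borel :: real measure)). (T \<le> t i \<and> x + z i \<in> U) \<and> (\<forall>j<i. \<not> (T \<le> t j \<and> x + z j \<in> U))}"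
    have comp[measurable]: "(\<lambda>z. z j) \<in> borel_measurable (PiM {..i} (\<lambda>_. borel :: real measure))" if "j \<le> i" for j
      by (rule measurable_component_singleton) (use that in simp)
    have "D \<in> sets (PiM {..i} (\<lambda>_. borel))"
    proof -
      have 1: "{z\<in>space (PiM {..i} (\<lambda>_. borel :: real measure)). T \<le> t j \<and> x + z j \<in> U} \<in> sets (PiM {..i} (\<lambda>_. borel))"
        if "j \<le> i" for j
        using comp[OF that] by measurable
      have "D = {z\<in>space (PiM {..i} (\<lambda>_. borel :: real measure)). T \<le> t i \<and> x + z i \<in> U} -
          (\<Union>j\<in>{..<i}. {z\<in>space (PiM {..i} (\<lambda>_. borel :: real measure)). T \<le> t j \<and> x + z j \<in> U})"
        unfolding D_def by auto
      also have "\<dots> \<in> sets (PiM {..i} (\<lambda>_. borel))" by (intro sets.Diff sets.finite_UN 1) auto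
      finally show ?thesis .
    qed
    then have [measurable]: "(indicator D :: _ \<Rightarrow> ennreal) \<in> borel_measurable (PiM {..i} (\<lambda>_. borel))" by simp
    have D: "indicator D (\<lambda>j\<in>{..i}. Y (t j) \<omega>) = (indicator (C i) \<omega> :: ennreal)" if "\<omega> \<in> space M" for \<omega>
    proof -
      have "(\<lambda>j\<in>{..i}. Y (t j) \<omega>) \<in> D \<longleftrightarrow> \<omega> \<in> C i"
        using that by (auto simp: D_def C_def hit_def space_PiM)
      then show ?thesis by (simp add: indicator_def)
    qed
    have "emeasure M {\<omega>\<in>C i. tail_integral g x (t i) \<omega> \<in> B} =
        (\<integral>\<^sup>+ \<omega>. indicator {\<omega>\<in>C i. tail_integral g x (t i) \<omega> \<in> B} \<omega> \<partial>M)"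
    proof (rule nn_integral_indicator[symmetric])
      have "{\<omega>\<in>C i. tail_integral g x (t i) \<omega> \<in> B} = C i \<inter> {\<omega>\<in>space M. tail_integral g x (t i) \<omega> \<in> B}"
        by (auto simp: C_def)
      also have "\<dots> \<in> sets M" by measurable
      finally show "{\<omega>\<in>C i. tail_integral g x (t i) \<omega> \<in> B} \<in> sets M" .
    qed
    also have "\<dots> = (\<integral>\<^sup>+ \<omega>. indicator D (\<lambda>j\<in>{..i}. Y (t j) \<omega>) * indicator B (tail_integral g x (t i) \<omega>) \<partial>M)"
    proof (rule nn_integral_cong)
      fix \<omega> assume "\<omega> \<in> space M"
      then show "indicator {\<omega>\<in>C i. tail_integral g x (t i) \<omega> \<in> B} \<omega> =
          (indicator D (\<lambda>j\<in>{..i}. Y (t j) \<omega>) * indicator B (tail_integral g x (t i) \<omega>) :: ennreal)"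
        unfolding D[OF \<open>\<omega> \<in> space M\<close>] by (simp add: indicator_def)
    qed
    also have "\<dots> = (\<integral>\<^sup>+ \<omega>. indicator D (\<lambda>j\<in>{..i}. Y (t j) \<omega>) * perpetual_prob g B (x + Y (t i) \<omega>) \<partial>M)"
      by (rule markov_tail_integral[OF t0 mono]) measurable
    also have "\<dots> = (\<integral>\<^sup>+ \<omega>. indicator (C i) \<omega> * perpetual_prob g B (x + Y (t i) \<omega>) \<partial>M)"
      by (intro nn_integral_cong) (simp add: D)
    finally show ?thesis .
  qed
  \<comment> \<open>The event \<open>C i\<close> belongs to the past of \<open>t i\<close>, so \<open>C_markov\<close> applies with \<open>B = {..<\<infinity>}\<close> and \<open>B = {..1}\<close>.\<close>
  have C_bound: "p / 2 * prob (C i) \<le> prob (C i \<inter> F)" for i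
  proof (cases "C i = {}")
    case False
    then have Ti: "T \<le> t i" by (auto simp: C_def hit_def)
    have [measurable]: "{\<omega>\<in>C i. tail_integral g x (t i) \<omega> \<in> B} \<in> sets M" if [measurable]: "B \<in> sets borel" for B
    proof -
      have "{\<omega>\<in>C i. tail_integral g x (t i) \<omega> \<in> B} = C i \<inter> {\<omega>\<in>space M. tail_integral g x (t i) \<omega> \<in> B}"
        by (auto simp: C_def)
      also have "\<dots> \<in> sets M" by measurable
      finally show ?thesis .
    qed
    have const: "(\<integral>\<^sup>+ \<omega>. indicator (C i) \<omega> * ennreal c \<partial>M) = ennreal (c * prob (C i))" if "0 \<le> c" for c
    proof -
      have "(\<integral>\<^sup>+ \<omega>. indicator (C i) \<omega> * ennreal c \<partial>M) = ennreal c * emeasure M (C i)"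
        by (subst mult.commute) (rule nn_integral_cmult_indicator, simp)
      then show ?thesis using that by (simp add: emeasure_eq_measure ennreal_mult)
    qed
    have "ennreal (p * prob (C i)) = (\<integral>\<^sup>+ \<omega>. indicator (C i) \<omega> * ennreal p \<partial>M)"
      using p(2) by (simp only: const less_imp_le)
    also have "\<dots> = (\<integral>\<^sup>+ \<omega>. indicator (C i) \<omega> * perpetual_prob g {..<\<infinity>} (x + Y (t i) \<omega>) \<partial>M)"
      using finiteness_prob_AE_const[OF g fin t_nn, of x i]
      by (intro nn_integral_cong_AE) (auto simp: p(1)[unfolded infinity_ennreal_def] elim!: eventually_mono)
    also have "\<dots> = emeasure M {\<omega>\<in>C i. tail_integral g x (t i) \<omega> \<in> {..<\<infinity>}}"
      by (rule C_markov[symmetric]) simp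
    also have "\<dots> \<le> emeasure M ((C i \<inter> F) \<union> {\<omega>\<in>C i. tail_integral g x (t i) \<omega> \<in> {..1}})"
    proof (rule emeasure_mono_AE)
      show "AE \<omega> in M. \<omega> \<in> {\<omega>\<in>C i. tail_integral g x (t i) \<omega> \<in> {..<\<infinity>}} \<longrightarrow>
          \<omega> \<in> (C i \<inter> F) \<union> {\<omega>\<in>C i. tail_integral g x (t i) \<omega> \<in> {..1}}"
        using tail_integral_finite_iff[OF g fin t_nn[of i], of x]
      proof (rule AE_mp, intro AE_I2 impI)
        fix \<omega> assume "\<omega> \<in> space M" and iff: "tail_integral g x (t i) \<omega> < \<infinity> \<longleftrightarrow> tail_integral g x 0 \<omega> < \<infinity>"
          and *: "\<omega> \<in> {\<omega>\<in>C i. tail_integral g x (t i) \<omega> \<in> {..<\<infinity>}}"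
        show "\<omega> \<in> (C i \<inter> F) \<union> {\<omega>\<in>C i. tail_integral g x (t i) \<omega> \<in> {..1}}"
        proof (cases "tail_integral g x (t i) \<omega> \<le> 1")
          case False
          then have "1 < tail_integral g x T \<omega>"
            using tail_integral_antimono[OF Ti, of g x \<omega>] by (auto intro: less_le_trans)
          then show ?thesis using * iff \<open>\<omega> \<in> space M\<close> by (simp add: F_def)
        qed (use * in simp)
      qed
    qed measurable
    also have "\<dots> \<le> emeasure M (C i \<inter> F) + emeasure M {\<omega>\<in>C i. tail_integral g x (t i) \<omega> \<in> {..1}}"
      by (rule emeasure_subadditive) measurable
    also have "emeasure M {\<omega>\<in>C i. tail_integral g x (t i) \<omega> \<in> {..1}} =
        (\<integral>\<^sup>+ \<omega>. indicator (C i) \<omega> * perpetual_prob g {..1} (x + Y (t i) \<omega>) \<partial>M)"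
      by (rule C_markov) simp
    also have "\<dots> \<le> (\<integral>\<^sup>+ \<omega>. indicator (C i) \<omega> * ennreal (p / 2) \<partial>M)"
      by (intro nn_integral_mono) (auto simp: indicator_def C_def hit_def small)
    also have "\<dots> = ennreal (p / 2 * prob (C i))"
      using p(2) by (intro const) simp
    finally have "ennreal (p * prob (C i)) \<le> ennreal (prob (C i \<inter> F) + p / 2 * prob (C i))"
      using p(2) by (simp add: emeasure_eq_measure add_left_mono flip: ennreal_plus)
    then have "p * prob (C i) \<le> prob (C i \<inter> F) + p / 2 * prob (C i)"
      using p(2) by (subst (asm) ennreal_le_iff) auto
    then show ?thesis by (simp add: field_simps)
  qed simp
  have disj: "disjoint_family C"
    unfolding disjoint_family_on_def C_def by (auto, metis linorder_neqE_nat)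
  have UN: "{\<omega>\<in>space M. \<exists>i\<le>K. T \<le> t i \<and> x + Y (t i) \<omega> \<in> U} = (\<Union>i\<in>{..K}. C i)"
  proof (intro set_eqI iffI)
    fix \<omega> assume "\<omega> \<in> {\<omega>\<in>space M. \<exists>i\<le>K. T \<le> t i \<and> x + Y (t i) \<omega> \<in> U}"
    then obtain i where \<omega>: "\<omega> \<in> space M" and i: "i \<le> K" "hit i \<omega>" by (auto simp: hit_def)
    define n where "n = (LEAST i. hit i \<omega>)"
    have "hit n \<omega>" unfolding n_def using i(2) by (rule LeastI)
    moreover have "n \<le> i" unfolding n_def using i(2) by (rule Least_le)
    moreover have "\<not> hit j \<omega>" if "j < n" for j using that unfolding n_def by (rule not_less_Least)
    ultimately show "\<omega> \<in> (\<Union>i\<in>{..K}. C i)" using \<omega> i(1) by (auto simp: C_def intro!: bexI[of _ n])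
  qed (auto simp: C_def hit_def)
  have "p / 2 * prob (\<Union>i\<in>{..K}. C i) = (\<Sum>i\<in>{..K}. p / 2 * prob (C i))"
    using disj unfolding sum_distrib_left[symmetric]
    by (subst finite_measure_finite_Union) (auto simp: disjoint_family_on_def)
  also have "\<dots> \<le> (\<Sum>i\<in>{..K}. prob (C i \<inter> F))" by (intro sum_mono C_bound)
  also have "\<dots> = prob (\<Union>i\<in>{..K}. C i \<inter> F)"
    using disj by (intro finite_measure_finite_Union[symmetric]) (auto simp: disjoint_family_on_def)
  also have "\<dots> \<le> prob F" by (intro finite_measure_mono) auto
  finally show ?thesis using p(2) unfolding UN F_def by (simp add: field_simps)
qed


lemma tail_integral_vanishes:
  assumes [measurable]: "g \<in> borel_measurable borel" and \<omega>: "\<omega> \<in> space M"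
    and fin: "tail_integral g x 0 \<omega> < \<infinity>" and c: "0 < c"
  shows "\<exists>n. tail_integral g x (real n) \<omega> < c"
proof -
  note [measurable] = measurable_section[OF \<omega>]
  define \<nu> where "\<nu> = density lborel (\<lambda>s. g (x + Y (max 0 s) \<omega>))"
  have \<nu>: "emeasure \<nu> {t..} = tail_integral g x t \<omega>" if "0 \<le> t" for t
    unfolding \<nu>_def tail_integral_eq_max[OF that] by (simp add: emeasure_density)
  have "(INF n. emeasure \<nu> {real n..}) = emeasure \<nu> (\<Inter>n. {real n..})"
  proof (rule INF_emeasure_decseq)
    show "emeasure \<nu> {real n..} \<noteq> \<infinity>" for n
      using tail_integral_antimono[of 0 "real n" g x \<omega>] fin by (auto simp: \<nu> top_unique)
  qed (auto simp: \<nu>_def decseq_def)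
  also have "(\<Inter>n. {real n..}) = {}"
  proof (rule equals0I)
    fix s assume "s \<in> (\<Inter>n. {real n..})"
    then have "real n \<le> s" for n by auto
    then show False using reals_Archimedean2[of s] by (meson not_le)
  qed
  finally have "(INF n. emeasure \<nu> {real n..}) < c" using c by simp
  then show ?thesis by (auto simp: INF_less_iff \<nu>)
qed

text \<open>
  A right-continuous path that visits the open set \<open>U\<close> at some time after \<open>n\<close> also visits it at a
  time of a fine dyadic grid, so \<open>hitting_prob_grid\<close> bounds the probability of any visit after \<open>n\<close>.
  The bound vanishes as \<open>n \<rightarrow> \<infinity>\<close>, because a finite perpetual integral has vanishing tails.
\<close>
lemma eventually_avoids_open:
  assumes g[measurable]: "g \<in> borel_measurable borel" and fin: "locally_finite g"
    and p: "perpetual_prob g {..<\<infinity>} x = ennreal p" "0 < p"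
    and O: "open U" and small: "\<And>y. y \<in> U \<Longrightarrow> perpetual_prob g {..1} y \<le> ennreal (p / 2)"
  shows "AE \<omega> in M. \<exists>\<tau>\<ge>0. \<forall>s\<ge>\<tau>. x + Y s \<omega> \<notin> U"
proof -
  have [measurable]: "U \<in> sets borel" using O by simp
  define grid where "grid m i = real i / 2 ^ m" for m i :: nat
  \<comment> \<open>Up to \<open>4 ^ m\<close> steps of length \<open>1 / 2 ^ m\<close>: both mesh and range of the grid improve with \<open>m\<close>.\<close>
  define A where "A n m = {\<omega>\<in>space M. \<exists>i\<le>4 ^ m. real n \<le> grid m i \<and> x + Y (grid m i) \<omega> \<in> U}" for n m :: nat
  define B where "B n = (\<Union>m. A n m)" for n
  define F where "F n = {\<omega>\<in>space M. tail_integral g x 0 \<omega> < \<infinity> \<and> 1 < tail_integral g x (real n) \<omega>}" for n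
  have [measurable]: "A n m \<in> sets M" for n m unfolding A_def by measurable
  have [measurable]: "B n \<in> sets M" for n unfolding B_def by measurable
  have [measurable]: "F n \<in> sets M" for n
  proof -
    note [measurable] = measurable_tail_integral[OF g, of 0 x, simplified] measurable_tail_integral[OF g, of "real n" x, simplified]
    show ?thesis unfolding F_def by measurable
  qed
  have B_le: "prob (B n) \<le> 2 / p * prob (F n)" for n
  proof -
    have "incseq (A n)"
    proof (rule incseq_SucI)
      fix m
      have "grid (Suc m) (2 * i) = grid m i" for i by (simp add: grid_def)
      moreover have "2 * i \<le> 4 ^ Suc m" if "i \<le> 4 ^ m" for i :: nat using that by simp
      ultimately show "A n m \<subseteq> A n (Suc m)" unfolding A_def by (smt (verit) Collect_mono_iff)
    qed
    then have "(\<lambda>m. prob (A n m)) \<longlonglongrightarrow> prob (B n)"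
      unfolding B_def by (intro finite_Lim_measure_incseq) auto
    moreover have "prob (A n m) \<le> 2 / p * prob (F n)" for m
      unfolding A_def F_def
      by (rule hitting_prob_grid[where t = "grid m"])
        (use fin p small in \<open>auto simp: grid_def divide_right_mono\<close>)
    ultimately show ?thesis by (blast intro: LIMSEQ_le_const2)
  qed
  have F_lim: "(\<lambda>n. prob (F n)) \<longlonglongrightarrow> 0"
  proof -
    have "(\<lambda>n. prob (F n)) \<longlonglongrightarrow> prob (\<Inter>n. F n)"
    proof (rule finite_Lim_measure_decseq)
      show "decseq F"
        unfolding decseq_def F_def using tail_integral_antimono[of "real _" "real _" g x]
        by (auto intro: less_le_trans)
    qed auto
    moreover have "(\<Inter>n. F n) = {}"
    proof (rule ccontr)
      assume "(\<Inter>n. F n) \<noteq> {}"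
      then obtain \<omega> where \<omega>: "\<And>n. \<omega> \<in> F n" by auto
      then have "\<exists>n. tail_integral g x (real n) \<omega> < 1"
        by (intro tail_integral_vanishes) (auto simp: F_def)
      then show False using \<omega> by (auto simp: F_def dest: less_asym)
    qed
    ultimately show ?thesis by simp
  qed
  have "prob (\<Inter>n. B n) = 0"
  proof -
    have "prob (\<Inter>n. B n) \<le> 2 / p * prob (F n)" for n
      by (rule order_trans[OF finite_measure_mono B_le]) auto
    moreover have "(\<lambda>n. 2 / p * prob (F n)) \<longlonglongrightarrow> 2 / p * 0" by (intro tendsto_intros F_lim)
    ultimately have "prob (\<Inter>n. B n) \<le> 2 / p * 0" by (intro LIMSEQ_le_const) auto
    then show ?thesis by (simp add: measure_le_0_iff)
  qed
  then have "AE \<omega> in M. \<omega> \<notin> (\<Inter>n. B n)"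
    by (intro AE_not_in) (simp add: null_setsI emeasure_eq_measure)
  then show ?thesis
  proof (rule AE_mp, intro AE_I2 impI)
    fix \<omega> assume \<omega>: "\<omega> \<in> space M" and "\<omega> \<notin> (\<Inter>n. B n)"
    then obtain n where n: "\<And>m. \<omega> \<notin> A n m" by (auto simp: B_def)
    have "x + Y s \<omega> \<notin> U" if s: "real n \<le> s" for s
    proof
      assume in_O: "x + Y s \<omega> \<in> U"
      have s0: "0 \<le> s" using s by linarith
      have "((\<lambda>r. x + Y r \<omega>) \<longlongrightarrow> x + Y s \<omega>) (at_right s)"
        using right_continuous[OF \<omega>, of s] by (intro tendsto_intros)
      then have "\<forall>\<^sub>F r in at_right s. x + Y r \<omega> \<in> U" using O in_O by (rule topological_tendstoD)
      then have ev1: "\<forall>\<^sub>F m in sequentially. x + Y (dyadic_above m s) \<omega> \<in> U"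
        using filterlim_dyadic_above[OF s0] by (rule eventually_compose_filterlim)
      have ev2: "\<forall>\<^sub>F m in sequentially. s < dyadic_above m s"
        using filterlim_dyadic_above[OF s0] by (auto simp: filterlim_at elim: eventually_mono)
      have ev3: "\<forall>\<^sub>F m in sequentially. 2 ^ m * s + 1 \<le> 4 ^ m" by real_asymp
      obtain m where m: "x + Y (dyadic_above m s) \<omega> \<in> U" "s < dyadic_above m s" "2 ^ m * s + 1 \<le> 4 ^ m"
        using eventually_happens[OF eventually_conj[OF ev1 eventually_conj[OF ev2 ev3]]] by auto
      define i where "i = nat \<lfloor>2 ^ m * s\<rfloor> + 1"
      have i: "dyadic_above m s = grid m i" by (simp add: dyadic_above_def grid_def i_def)
      have "real i \<le> 2 ^ m * s + 1" unfolding i_def using s0 by simp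
      then have "real i \<le> 4 ^ m" using m(3) by (rule order_trans)
      then have "real i \<le> real (4 ^ m)" by (simp only: of_nat_power of_nat_numeral)
      then have "i \<le> 4 ^ m" by (simp only: of_nat_le_iff)
      moreover have "real n \<le> grid m i" using m(2) s unfolding i by linarith
      ultimately show False using n[of m] m(1) \<omega> unfolding i A_def by auto
    qed
    then show "\<exists>\<tau>\<ge>0. \<forall>s\<ge>\<tau>. x + Y s \<omega> \<notin> U" by (intro exI[of _ "real n"]) auto
  qed
qed

section \<open>The integral test\<close>

lemma expected_restricted_integral:
  assumes [measurable]: "g \<in> borel_measurable borel" "E \<in> sets borel"
  shows "(\<integral>\<^sup>+ s\<in>{0..}. (\<integral>\<^sup>+ \<omega>. g (x + Y s \<omega>) * indicator E (x + Y s \<omega>) \<partial>M) \<partial>lborel) =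
    (\<integral>\<^sup>+ \<omega>. tail_integral (\<lambda>y. g y * indicator E y) x 0 \<omega> \<partial>M)"
proof -
  interpret L: pair_sigma_finite lborel M ..
  have "(\<integral>\<^sup>+ s\<in>{0..}. (\<integral>\<^sup>+ \<omega>. g (x + Y s \<omega>) * indicator E (x + Y s \<omega>) \<partial>M) \<partial>lborel) =
      (\<integral>\<^sup>+ s. (\<integral>\<^sup>+ \<omega>. g (x + Y (max 0 s) \<omega>) * indicator E (x + Y (max 0 s) \<omega>) * indicator {0..} s \<partial>M) \<partial>lborel)"
    by (intro nn_integral_cong) (auto simp: indicator_def)
  also have "\<dots> = (\<integral>\<^sup>+ \<omega>. (\<integral>\<^sup>+ s. g (x + Y (max 0 s) \<omega>) * indicator E (x + Y (max 0 s) \<omega>) * indicator {0..} s \<partial>lborel) \<partial>M)"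
    by (rule L.Fubini'[symmetric]) measurable
  also have "\<dots> = (\<integral>\<^sup>+ \<omega>. tail_integral (\<lambda>y. g y * indicator E y) x 0 \<omega> \<partial>M)"
    unfolding tail_integral_def by (intro nn_integral_cong) (auto simp: indicator_def)
  finally show ?thesis .
qed

text \<open>
  By the Markov property at each fixed time \<open>s\<close>, \<open>c\<close> times the expectation of \<open>g\<close> on \<open>E\<close> is at most the
  expectation of \<open>g\<close> on the event that the integral after \<open>s\<close> is at most \<open>1\<close>. Integrated over \<open>s\<close>,
  the latter is bounded path by path by \<open>emeasure_tail_le_const\<close>, applied to the measure with density
  \<open>g\<close> along the path.
\<close>
lemma potential_bound:
  assumes g[measurable]: "g \<in> borel_measurable borel" and E[measurable]: "E \<in> sets borel"
    and large: "\<And>y. y \<in> E \<Longrightarrow> c \<le> perpetual_prob g {..1} y"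
  shows "c * (\<integral>\<^sup>+ s\<in>{0..}. (\<integral>\<^sup>+ \<omega>. g (x + Y s \<omega>) * indicator E (x + Y s \<omega>) \<partial>M) \<partial>lborel) \<le> 1"
proof -
  interpret L: pair_sigma_finite lborel M ..
  define a where "a s \<omega> = g (x + Y (max 0 s) \<omega>)" for s \<omega>
  define late where "late s \<omega> = (\<integral>\<^sup>+ r. a r \<omega> * indicator {s..} r \<partial>lborel)" for s \<omega>
  have [measurable]: "case_prod a \<in> borel_measurable (lborel \<Otimes>\<^sub>M M)" unfolding a_def by measurable
  have [measurable]: "case_prod late \<in> borel_measurable (lborel \<Otimes>\<^sub>M M)"
    unfolding late_def by (simp add: indicator_def if_distrib[where f = "\<lambda>z. _ * z"] cong: if_cong)
  have late: "late s \<omega> = tail_integral g x s \<omega>" if "0 \<le> s" for s \<omega>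
    unfolding late_def a_def using tail_integral_eq_max[OF that] by simp
  have "c * (\<integral>\<^sup>+ s\<in>{0..}. (\<integral>\<^sup>+ \<omega>. g (x + Y s \<omega>) * indicator E (x + Y s \<omega>) \<partial>M) \<partial>lborel) =
      c * (\<integral>\<^sup>+ s. (\<integral>\<^sup>+ \<omega>. a s \<omega> * indicator E (x + Y (max 0 s) \<omega>) \<partial>M) * indicator {0..} s \<partial>lborel)"
    by (intro arg_cong[where f = "\<lambda>z. c * z"] nn_integral_cong) (auto simp: a_def indicator_def)
  also have "\<dots> = (\<integral>\<^sup>+ s. c * ((\<integral>\<^sup>+ \<omega>. a s \<omega> * indicator E (x + Y (max 0 s) \<omega>) \<partial>M) * indicator {0..} s) \<partial>lborel)"
    by (rule nn_integral_cmult[symmetric]) measurable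
  also have "\<dots> \<le> (\<integral>\<^sup>+ s. (\<integral>\<^sup>+ \<omega>. a s \<omega> * indicator {..1} (late s \<omega>) * indicator {0..} s \<partial>M) \<partial>lborel)"
  proof (rule nn_integral_mono)
    fix s :: real
    show "c * ((\<integral>\<^sup>+ \<omega>. a s \<omega> * indicator E (x + Y (max 0 s) \<omega>) \<partial>M) * indicator {0..} s) \<le>
      (\<integral>\<^sup>+ \<omega>. a s \<omega> * indicator {..1} (late s \<omega>) * indicator {0..} s \<partial>M)"
    proof (cases "0 \<le> s")
      case True
      have "c * (\<integral>\<^sup>+ \<omega>. a s \<omega> * indicator E (x + Y (max 0 s) \<omega>) \<partial>M) =
          (\<integral>\<^sup>+ \<omega>. c * (g (x + Y s \<omega>) * indicator E (x + Y s \<omega>)) \<partial>M)"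
        unfolding a_def using True by (simp add: nn_integral_cmult)
      also have "\<dots> \<le> (\<integral>\<^sup>+ \<omega>. g (x + Y s \<omega>) * perpetual_prob g {..1} (x + Y s \<omega>) \<partial>M)"
        by (intro nn_integral_mono) (auto simp: indicator_def mult.commute[of c] intro!: mult_left_mono large)
      also have "\<dots> = (\<integral>\<^sup>+ \<omega>. g (x + Y s \<omega>) * indicator {..1} (tail_integral g x s \<omega>) \<partial>M)"
        using markov_tail_integral_single[OF True g, of "{..1}" "\<lambda>y. g (x + y)" x] by simp
      also have "\<dots> = (\<integral>\<^sup>+ \<omega>. a s \<omega> * indicator {..1} (late s \<omega>) * indicator {0..} s \<partial>M)"
        using True by (simp add: late a_def)
      finally show ?thesis using True by simp
    qed simp
  qed
  also have "\<dots> = (\<integral>\<^sup>+ \<omega>. (\<integral>\<^sup>+ s. a s \<omega> * indicator {..1} (late s \<omega>) * indicator {0..} s \<partial>lborel) \<partial>M)"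
    by (rule L.Fubini'[symmetric]) measurable
  also have "\<dots> \<le> (\<integral>\<^sup>+ \<omega>. 1 \<partial>M)"
  proof (rule nn_integral_mono)
    fix \<omega> assume \<omega>: "\<omega> \<in> space M"
    note [measurable] = measurable_section[OF \<omega>]
    have [measurable]: "(\<lambda>s. a s \<omega>) \<in> borel_measurable borel" unfolding a_def by measurable
    have [measurable]: "(\<lambda>s. late s \<omega>) \<in> borel_measurable borel"
      using measurable_compose[OF measurable_Pair2'[OF \<omega>, of lborel], of "case_prod late" borel] by simp
    define \<nu> where "\<nu> = density lborel (\<lambda>s. a s \<omega>)"
    have \<nu>_tail: "emeasure \<nu> {s..} = late s \<omega>" for s
      unfolding \<nu>_def late_def by (simp add: emeasure_density)
    have "(\<integral>\<^sup>+ s. a s \<omega> * indicator {..1} (late s \<omega>) * indicator {0..} s \<partial>lborel) =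
        (\<integral>\<^sup>+ s. a s \<omega> * indicator {s. 0 \<le> s \<and> late s \<omega> \<le> 1} s \<partial>lborel)"
      by (intro nn_integral_cong) (auto simp: indicator_def)
    also have "\<dots> = emeasure \<nu> {s. 0 \<le> s \<and> emeasure \<nu> {s..} \<le> 1}"
      unfolding \<nu>_tail unfolding \<nu>_def by (rule emeasure_density[symmetric]) simp_all
    also have "\<dots> \<le> 1" by (rule emeasure_tail_le_const) (simp add: \<nu>_def)
    finally show "(\<integral>\<^sup>+ s. a s \<omega> * indicator {..1} (late s \<omega>) * indicator {0..} s \<partial>lborel) \<le> 1" .
  qed
  also have "\<dots> = 1" by (simp add: emeasure_space_1)
  finally show ?thesis .
qed

text \<open>
  The complement of \<open>{y. P(I y > 1) > 1 - p / 2}\<close> is the required set: that set is open by lower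
  semicontinuity, it is avoided eventually, and off it \<open>P(I y \<le> 1) \<ge> p / 2\<close>.
\<close>
theorem not_AE_infinite_imp_potential_finite:
  assumes g[measurable]: "g \<in> borel_measurable borel" and fin: "locally_finite g"
    and lsc: "seq_lsc (perpetual_prob g {1<..})"
    and not_inf: "\<not> (AE \<omega> in M. \<not> tail_integral g x 0 \<omega> < \<infinity>)"
  shows "\<exists>E\<in>sets borel. (AE \<omega> in M. \<exists>\<tau>\<ge>0. \<forall>s\<ge>\<tau>. x + Y s \<omega> \<in> E) \<and>
    (\<integral>\<^sup>+ s\<in>{0..}. (\<integral>\<^sup>+ \<omega>. g (x + Y s \<omega>) * indicator E (x + Y s \<omega>) \<partial>M) \<partial>lborel) < \<infinity>"
proof -
  define p where "p = enn2real (perpetual_prob g {..<\<infinity>} x)"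
  have p_eq: "perpetual_prob g {..<\<infinity>} x = ennreal p"
    unfolding p_def using perpetual_prob_le_1[of g "{..<\<infinity>}" x]
    by (intro ennreal_enn2real[symmetric]) (auto intro: le_less_trans)
  have "perpetual_prob g {..<\<infinity>} x \<noteq> 0"
  proof
    assume "perpetual_prob g {..<\<infinity>} x = 0"
    then have "(\<integral>\<^sup>+ \<omega>. indicator {..<\<infinity>} (tail_integral g x 0 \<omega>) \<partial>M) = 0"
      by (simp add: perpetual_prob_eq)
    then have "AE \<omega> in M. (indicator {..<\<infinity>} (tail_integral g x 0 \<omega>) :: ennreal) = 0"
      by (subst (asm) nn_integral_0_iff_AE) auto
    then have "AE \<omega> in M. \<not> tail_integral g x 0 \<omega> < \<infinity>"
      by (rule eventually_mono) (auto simp: indicator_def split: if_splits)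
    then show False using not_inf by simp
  qed
  then have p_pos: "0 < p" unfolding p_eq by (simp add: ennreal_eq_0_iff)
  have p_le: "p \<le> 1" using perpetual_prob_le_1[of g "{..<\<infinity>}" x] unfolding p_eq by simp
  define U where "U = {y. ennreal (1 - p / 2) < perpetual_prob g {1<..} y}"
  have "open U" unfolding U_def using lsc by (rule seq_lsc_imp_open)
  have sum1: "perpetual_prob g {..1} y + perpetual_prob g {1<..} y = 1" for y
  proof -
    have "- {..1} = {1 :: ennreal<..}" by auto
    then show ?thesis using perpetual_prob_compl[OF g, of "{..1}" y] by simp
  qed
  have split: "ennreal (1 - p / 2) + ennreal (p / 2) = 1" using p_pos p_le by (simp flip: ennreal_plus)
  have small: "perpetual_prob g {..1} y \<le> ennreal (p / 2)" if "y \<in> U" for y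
  proof (rule ccontr)
    assume "\<not> ?thesis"
    then have "ennreal (p / 2) < perpetual_prob g {..1} y" by simp
    with that have "ennreal (p / 2) + ennreal (1 - p / 2) < perpetual_prob g {..1} y + perpetual_prob g {1<..} y"
      unfolding U_def by (intro add_strict_mono) auto
    then show False using sum1 split by (simp add: add.commute)
  qed
  have large: "ennreal (p / 2) \<le> perpetual_prob g {..1} y" if "y \<in> - U" for y
  proof (rule ccontr)
    assume "\<not> ?thesis"
    then have *: "perpetual_prob g {..1} y < ennreal (p / 2)" by simp
    have "perpetual_prob g {1<..} y \<le> ennreal (1 - p / 2)" using that by (simp add: U_def not_less)
    then have "perpetual_prob g {..1} y + perpetual_prob g {1<..} y \<le> perpetual_prob g {..1} y + ennreal (1 - p / 2)"
      by (rule add_left_mono)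
    then have "1 \<le> ennreal (1 - p / 2) + perpetual_prob g {..1} y"
      unfolding sum1 by (simp only: add.commute)
    also have "\<dots> < ennreal (1 - p / 2) + ennreal (p / 2)"
      using * by (simp add: ennreal_add_left_cancel_less)
    finally show False using split by simp
  qed
  have E[measurable]: "- U \<in> sets borel" using \<open>open U\<close> by simp
  have "AE \<omega> in M. \<exists>\<tau>\<ge>0. \<forall>s\<ge>\<tau>. x + Y s \<omega> \<in> - U"
    using eventually_avoids_open[OF g fin p_eq p_pos \<open>open U\<close> small] by simp
  moreover have "(\<integral>\<^sup>+ s\<in>{0..}. (\<integral>\<^sup>+ \<omega>. g (x + Y s \<omega>) * indicator (- U) (x + Y s \<omega>) \<partial>M) \<partial>lborel) < \<infinity>"
  proof (rule ccontr)
    assume "\<not> ?thesis"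
    then have "(\<integral>\<^sup>+ s\<in>{0..}. (\<integral>\<^sup>+ \<omega>. g (x + Y s \<omega>) * indicator (- U) (x + Y s \<omega>) \<partial>M) \<partial>lborel) = \<top>"
      by (simp add: less_top[symmetric])
    then show False using potential_bound[OF g E large, of x] p_pos by (simp add: ennreal_mult_top top_unique)
  qed
  ultimately show ?thesis using E by blast
qed

theorem potential_finite_imp_AE_finite:
  assumes g[measurable]: "g \<in> borel_measurable borel" and fin: "locally_finite g" and E[measurable]: "E \<in> sets borel"
    and trans: "AE \<omega> in M. \<exists>\<tau>\<ge>0. \<forall>s\<ge>\<tau>. x + Y s \<omega> \<in> E"
    and pot: "(\<integral>\<^sup>+ s\<in>{0..}. (\<integral>\<^sup>+ \<omega>. g (x + Y s \<omega>) * indicator E (x + Y s \<omega>) \<partial>M) \<partial>lborel) < \<infinity>"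
  shows "AE \<omega> in M. tail_integral g x 0 \<omega> < \<infinity>"
proof -
  have "(\<integral>\<^sup>+ \<omega>. tail_integral (\<lambda>y. g y * indicator E y) x 0 \<omega> \<partial>M) \<noteq> \<infinity>"
    using pot unfolding expected_restricted_integral[OF g E] by simp
  then have "AE \<omega> in M. tail_integral (\<lambda>y. g y * indicator E y) x 0 \<omega> \<noteq> \<infinity>"
    by (intro nn_integral_noteq_infinite) auto
  moreover have "AE \<omega> in M. \<forall>t>0. (\<integral>\<^sup>+ s\<in>{0..t}. g (x + Y s \<omega>) \<partial>lborel) < \<infinity>"
    using fin by (simp add: locally_finite_def)
  ultimately have "AE \<omega> in M. tail_integral (\<lambda>y. g y * indicator E y) x 0 \<omega> \<noteq> \<infinity> \<and>
      (\<forall>t>0. (\<integral>\<^sup>+ s\<in>{0..t}. g (x + Y s \<omega>) \<partial>lborel) < \<infinity>) \<and> (\<exists>\<tau>\<ge>0. \<forall>s\<ge>\<tau>. x + Y s \<omega> \<in> E)"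
    using trans by eventually_elim blast
  then show ?thesis
  proof (rule AE_mp, intro AE_I2 impI, elim conjE exE)
    fix \<omega> \<tau> assume \<omega>: "\<omega> \<in> space M"
      and int: "tail_integral (\<lambda>y. g y * indicator E y) x 0 \<omega> \<noteq> \<infinity>"
      and loc: "\<forall>t>0. (\<integral>\<^sup>+ s\<in>{0..t}. g (x + Y s \<omega>) \<partial>lborel) < \<infinity>"
      and \<tau>: "0 \<le> \<tau>" "\<forall>s\<ge>\<tau>. x + Y s \<omega> \<in> E"
    \<comment> \<open>The integral over \<open>{0..t}\<close> is known to be finite for strictly positive \<open>t\<close> only.\<close>
    define t where "t = \<tau> + 1"
    have t: "0 < t" "\<tau> \<le> t" using \<tau>(1) by (auto simp: t_def)
    have "tail_integral g x t \<omega> = tail_integral (\<lambda>y. g y * indicator E y) x t \<omega>"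
      unfolding tail_integral_def using \<tau>(2) t(2) by (intro nn_integral_cong) (auto simp: indicator_def)
    also have "\<dots> \<le> tail_integral (\<lambda>y. g y * indicator E y) x 0 \<omega>"
      using t(1) by (intro tail_integral_antimono) simp
    finally have "tail_integral g x t \<omega> < \<infinity>" using int by (auto simp: less_top top_unique)
    then have "(\<integral>\<^sup>+ s\<in>{0..t}. g (x + Y s \<omega>) \<partial>lborel) + tail_integral g x t \<omega> < \<infinity>"
      using loc t(1) by simp
    then show "tail_integral g x 0 \<omega> < \<infinity>"
      using tail_integral_split[OF g \<omega>, of t x] t(1) by (auto intro: le_less_trans)
  qed
qed


section \<open>Lower semicontinuity in the starting point\<close>

lemma AE_lborel_swap:
  assumes [measurable]: "L \<in> sets borel" and L: "\<And>s x. 0 < s \<Longrightarrow> AE \<omega> in M. x + Y s \<omega> \<in> L"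
  shows "AE \<omega> in M. AE s in lborel. 0 \<le> s \<longrightarrow> x + Y (max 0 s) \<omega> \<in> L"
proof -
  interpret P: pair_sigma_finite lborel M ..
  have "AE s in lborel. AE \<omega> in M. 0 \<le> s \<longrightarrow> x + Y (max 0 s) \<omega> \<in> L"
    using AE_lborel_singleton[of 0]
  proof (rule eventually_mono)
    fix s :: real assume "s \<noteq> 0"
    then show "AE \<omega> in M. 0 \<le> s \<longrightarrow> x + Y (max 0 s) \<omega> \<in> L"
      using L[of s x] by (cases "0 < s") auto
  qed
  then show ?thesis by (subst (asm) P.AE_commute) measurable
qed

text \<open>
  Fatou's lemma twice: first in time, so that the perpetual integral of each fixed path is lower
  semicontinuous in the starting point, then in the path.
\<close>
lemma seq_lsc_perpetual_prob_of_lsc: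
  assumes [measurable]: "g \<in> borel_measurable borel" and lsc: "seq_lsc g"
  shows "seq_lsc (perpetual_prob g {1<..})"
  unfolding perpetual_prob_def
proof (rule seq_lsc_nn_integral)
  fix w assume "w \<in> space path_law"
  then have w: "w \<in> space path_space" using sets_eq_imp_space_eq[OF sets_path_law] by simp
  have [measurable]: "path_of w \<in> borel_measurable borel"
    using measurable_compose[OF measurable_Pair2'[OF w, of borel] measurable_path_of] by simp
  have "seq_lsc (\<lambda>y. path_integral g y w)"
    unfolding path_integral_def
  proof (rule seq_lsc_nn_integral)
    fix s :: real
    show "seq_lsc (\<lambda>y. g (y + path_of w s) * indicator {0..} s)"
      using seq_lsc_shift[OF lsc, of "path_of w s"] by (cases "0 \<le> s") (auto simp: seq_lsc_def)
  qed measurable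
  then show "seq_lsc (\<lambda>y. indicator {1<..} (path_integral g y w))" by (rule seq_lsc_indicator)
qed measurable

text \<open>
  By Tonelli's theorem the path almost surely spends almost all of its time in \<open>L\<close>, so the
  perpetual integral only sees the values on \<open>L\<close>.
\<close>
lemma perpetual_prob_cong:
  assumes [measurable]: "g \<in> borel_measurable borel" "h \<in> borel_measurable borel" "L \<in> sets borel" "B \<in> sets borel"
    and L: "\<And>s x. 0 < s \<Longrightarrow> AE \<omega> in M. x + Y s \<omega> \<in> L" and eq: "\<And>y. y \<in> L \<Longrightarrow> g y = h y"
  shows "perpetual_prob g B = perpetual_prob h B"
proof
  fix x
  have "AE \<omega> in M. tail_integral g x 0 \<omega> = tail_integral h x 0 \<omega>"
    using AE_lborel_swap[OF assms(3) L, of x]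
  proof (rule eventually_mono)
    fix \<omega> assume "AE s in lborel. 0 \<le> s \<longrightarrow> x + Y (max 0 s) \<omega> \<in> L"
    then show "tail_integral g x 0 \<omega> = tail_integral h x 0 \<omega>"
      unfolding tail_integral_def
      by (intro nn_integral_cong_AE) (auto simp: indicator_def eq elim!: eventually_mono)
  qed
  then have "(\<integral>\<^sup>+ \<omega>. indicator B (tail_integral g x 0 \<omega>) \<partial>M) = (\<integral>\<^sup>+ \<omega>. indicator B (tail_integral h x 0 \<omega>) \<partial>M)"
    by (intro nn_integral_cong_AE) (auto elim!: eventually_mono)
  then show "perpetual_prob g B x = perpetual_prob h B x" by (simp add: perpetual_prob_eq)
qed

lemma tail_integral_eq_SUP:
  assumes [measurable]: "g \<in> borel_measurable borel" and \<omega>: "\<omega> \<in> space M"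
  shows "tail_integral g x 0 \<omega> = (SUP n. tail_integral g x (1 / real (Suc n)) \<omega>)"
proof -
  note [measurable] = measurable_section[OF \<omega>]
  define \<nu> where "\<nu> = density lborel (\<lambda>s. g (x + Y (max 0 s) \<omega>))"
  have \<nu>: "emeasure \<nu> {t..} = tail_integral g x t \<omega>" if "0 \<le> t" for t
    unfolding \<nu>_def tail_integral_eq_max[OF that] by (simp add: emeasure_density)
  have "(SUP n. emeasure \<nu> {1 / real (Suc n)..}) = emeasure \<nu> (\<Union>n. {1 / real (Suc n)..})"
  proof (rule SUP_emeasure_incseq)
    show "incseq (\<lambda>n. {1 / real (Suc n)..})"
    proof (rule incseq_SucI)
      fix n
      have "1 / real (Suc (Suc n)) \<le> 1 / real (Suc n)" by (intro divide_left_mono) auto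
      then show "{1 / real (Suc n)..} \<subseteq> {1 / real (Suc (Suc n))..}" by (auto simp del: of_nat_Suc)
    qed
  qed (auto simp: \<nu>_def)
  also have "(\<Union>n. {1 / real (Suc n)..}) = {0<..}"
  proof (intro set_eqI iffI)
    fix s :: real assume "s \<in> {0<..}"
    then obtain n where "1 / real (Suc n) < s" using nat_approx_posE[of s] by auto
    then show "s \<in> (\<Union>n. {1 / real (Suc n)..})" by (auto intro!: exI[of _ n])
  next
    fix s :: real assume "s \<in> (\<Union>n. {1 / real (Suc n)..})"
    then obtain n where "1 / real (Suc n) \<le> s" by auto
    then show "s \<in> {0<..}" by (auto intro: less_le_trans[rotated])
  qed
  also have "emeasure \<nu> {0<..} = emeasure \<nu> {0..}"
  proof -
    have "AE s in \<nu>. s \<noteq> 0"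
      unfolding \<nu>_def using AE_lborel_singleton[of 0] by (subst AE_density) (auto elim!: eventually_mono)
    then show ?thesis
      by (intro emeasure_eq_AE) (auto simp: \<nu>_def elim!: eventually_mono)
  qed
  finally show ?thesis by (simp add: \<nu> del: of_nat_Suc)
qed

text \<open>
  The integral over \<open>{\<epsilon>..}\<close> increases to the full one as \<open>\<epsilon> \<rightarrow> 0\<close>, and a supremum of lower
  semicontinuous functions is lower semicontinuous. For fixed \<open>\<epsilon>\<close> condition on the path after \<open>\<epsilon>\<close>:
  the event becomes that \<open>y + Y \<epsilon>\<close> lies in a fixed Borel set, to which \<open>seq_lsc_translate\<close> applies.
\<close>
lemma seq_lsc_perpetual_prob_of_ac:
  assumes g[measurable]: "g \<in> borel_measurable borel"
    and ac: "\<And>s A. 0 < s \<Longrightarrow> A \<in> null_sets lborel \<Longrightarrow> AE \<omega> in M. Y s \<omega> \<notin> A"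
  shows "seq_lsc (perpetual_prob g {1<..})"
proof -
  interpret L: prob_space path_law by (rule prob_space_path_law)
  define q where "q n y = (\<integral>\<^sup>+ \<omega>. indicator {1<..} (tail_integral g y (1 / real (Suc n)) \<omega>) \<partial>M)" for n y
  have "perpetual_prob g {1<..} y = (SUP n. q n y)" for y
  proof -
    have "perpetual_prob g {1<..} y = (\<integral>\<^sup>+ \<omega>. (SUP n. indicator {1<..} (tail_integral g y (1 / real (Suc n)) \<omega>)) \<partial>M)"
      unfolding perpetual_prob_eq[OF g greaterThan_borel]
    proof (rule nn_integral_cong)
      fix \<omega> assume \<omega>: "\<omega> \<in> space M"
      show "indicator {1<..} (tail_integral g y 0 \<omega>) =
          (SUP n. indicator {1<..} (tail_integral g y (1 / real (Suc n)) \<omega>) :: ennreal)"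
      proof (cases "1 < tail_integral g y 0 \<omega>")
        case True
        then obtain n where n: "1 < tail_integral g y (1 / real (Suc n)) \<omega>"
          unfolding tail_integral_eq_SUP[OF g \<omega>] by (auto simp: less_SUP_iff)
        have "(SUP n. indicator {1<..} (tail_integral g y (1 / real (Suc n)) \<omega>) :: ennreal) = 1"
        proof (rule antisym)
          show "1 \<le> (SUP n. indicator {1<..} (tail_integral g y (1 / real (Suc n)) \<omega>) :: ennreal)"
            using n by (intro SUP_upper2[of n]) auto
        qed (auto intro!: SUP_least simp: indicator_def)
        then show ?thesis using True by simp
      next
        case False
        then have "\<not> 1 < tail_integral g y (1 / real (Suc n)) \<omega>" for n
          unfolding tail_integral_eq_SUP[OF g \<omega>] by (auto simp: less_SUP_iff)
        then show ?thesis using False by simp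
      qed
    qed
    also have "\<dots> = (SUP n. q n y)"
      unfolding q_def
    proof (rule nn_integral_monotone_convergence_SUP)
      show "incseq (\<lambda>n \<omega>. indicator {1<..} (tail_integral g y (1 / real (Suc n)) \<omega>) :: ennreal)"
      proof (rule incseq_SucI, rule le_funI)
        fix n \<omega>
        have "1 / real (Suc (Suc n)) \<le> 1 / real (Suc n)" by (intro divide_left_mono) auto
        then have "tail_integral g y (1 / real (Suc n)) \<omega> \<le> tail_integral g y (1 / real (Suc (Suc n))) \<omega>"
          by (rule tail_integral_antimono)
        then show "indicator {1<..} (tail_integral g y (1 / real (Suc n)) \<omega>) \<le>
            (indicator {1<..} (tail_integral g y (1 / real (Suc (Suc n))) \<omega>) :: ennreal)"
          by (auto simp: indicator_def dest: less_le_trans)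
      qed
      show "(\<lambda>\<omega>. indicator {1<..} (tail_integral g y (1 / real (Suc n)) \<omega>) :: ennreal) \<in> borel_measurable M" for n
      proof -
        have [measurable]: "tail_integral g y (1 / real (Suc n)) \<in> borel_measurable M"
          by (rule measurable_tail_integral) auto
        show ?thesis by measurable
      qed
    qed
    finally show ?thesis .
  qed
  moreover have "seq_lsc (q n)" for n
  proof -
    define s where "s = 1 / real (Suc n)"
    have s: "0 < s" by (simp add: s_def)
    let ?\<mu> = "distr M borel (Y s)"
    interpret \<mu>: prob_space ?\<mu> by (rule prob_space_distr) simp
    interpret P: pair_sigma_finite ?\<mu> path_law ..
    have "q n y = (\<integral>\<^sup>+ w. emeasure ?\<mu> {z. y + z \<in> {v. 1 < path_integral g v w}} \<partial>path_law)" for y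
    proof -
      have "q n y = (\<integral>\<^sup>+ \<omega>. perpetual_prob g {1<..} (y + Y s \<omega>) \<partial>M)"
        using markov_tail_integral_single[of s g "{1<..}" "\<lambda>_. 1" y] s by (simp add: q_def s_def)
      also have "\<dots> = (\<integral>\<^sup>+ z. perpetual_prob g {1<..} (y + z) \<partial>?\<mu>)"
        by (rule nn_integral_distr[symmetric]) auto
      also have "\<dots> = (\<integral>\<^sup>+ w. (\<integral>\<^sup>+ z. indicator {1<..} (path_integral g (y + z) w) \<partial>?\<mu>) \<partial>path_law)"
        unfolding perpetual_prob_def by (rule P.Fubini'[symmetric]) measurable
      also have "\<dots> = (\<integral>\<^sup>+ w. emeasure ?\<mu> {z. y + z \<in> {v. 1 < path_integral g v w}} \<partial>path_law)"
      proof (rule nn_integral_cong)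
        fix w assume "w \<in> space path_law"
        then have w: "w \<in> space path_space" using sets_eq_imp_space_eq[OF sets_path_law] by simp
        have [measurable]: "(\<lambda>v. path_integral g v w) \<in> borel_measurable borel"
          using measurable_compose[OF measurable_Pair2'[OF w, of borel] measurable_path_integral[OF g]] by simp
        have "(\<integral>\<^sup>+ z. indicator {1<..} (path_integral g (y + z) w) \<partial>?\<mu>) =
            (\<integral>\<^sup>+ z. indicator {z. 1 < path_integral g (y + z) w} z \<partial>?\<mu>)"
          by (intro nn_integral_cong) (simp add: indicator_def)
        also have "\<dots> = emeasure ?\<mu> {z. 1 < path_integral g (y + z) w}"
          by (rule nn_integral_indicator) simp
        finally show "(\<integral>\<^sup>+ z. indicator {1<..} (path_integral g (y + z) w) \<partial>?\<mu>) =
            emeasure ?\<mu> {z. y + z \<in> {v. 1 < path_integral g v w}}" by simp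
      qed
      finally show ?thesis .
    qed
    moreover have "seq_lsc (\<lambda>y. \<integral>\<^sup>+ w. emeasure ?\<mu> {z. y + z \<in> {v. 1 < path_integral g v w}} \<partial>path_law)"
    proof (rule seq_lsc_nn_integral)
      fix w assume "w \<in> space path_law"
      then have w: "w \<in> space path_space" using sets_eq_imp_space_eq[OF sets_path_law] by simp
      have [measurable]: "(\<lambda>v. path_integral g v w) \<in> borel_measurable borel"
        using measurable_compose[OF measurable_Pair2'[OF w, of borel] measurable_path_integral[OF g]] by simp
      show "seq_lsc (\<lambda>y. emeasure ?\<mu> {z. y + z \<in> {v. 1 < path_integral g v w}})"
      proof (rule seq_lsc_translate)
        show "finite_measure ?\<mu>" by unfold_locales
        show "{v. 1 < path_integral g v w} \<in> sets borel" by measurable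
        fix A :: "real set" assume A: "A \<in> null_sets lborel"
        then have [measurable]: "A \<in> sets borel" by auto
        have "AE z in ?\<mu>. z \<notin> A" using ac[OF s A] by (subst AE_distr_iff) auto
        then show "emeasure ?\<mu> A = 0" by (subst (asm) AE_iff_null_sets[symmetric]) auto
      qed simp
    next
      fix y
      have "{z. y + z \<in> {v. 1 < path_integral g v w}} = Pair w -` {x\<in>space (path_law \<Otimes>\<^sub>M ?\<mu>). 1 < path_integral g (y + snd x) (fst x)}"
        if "w \<in> space path_law" for w
        using that by (auto simp: space_pair_measure)
      moreover have "(\<lambda>w. emeasure ?\<mu> (Pair w -` {x\<in>space (path_law \<Otimes>\<^sub>M ?\<mu>). 1 < path_integral g (y + snd x) (fst x)})) \<in> borel_measurable path_law"
        by (rule \<mu>.measurable_emeasure_Pair) measurable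
      ultimately show "(\<lambda>w. emeasure ?\<mu> {z. y + z \<in> {v. 1 < path_integral g v w}}) \<in> borel_measurable path_law"
        by (subst measurable_cong) auto
    qed
    ultimately show ?thesis by (simp add: seq_lsc_def)
  qed
  ultimately show ?thesis using seq_lsc_SUP[of UNIV q] by (simp add: seq_lsc_def)
qed

end

section \<open>Passage to the given process\<close>

lemma (in prob_space) indep_vars_cong_AE:
  assumes X: "indep_vars M' X I" and eq: "\<And>i. i \<in> I \<Longrightarrow> AE \<omega> in M. X i \<omega> = Z i \<omega>" and I: "countable I"
    and Z: "\<And>i. i \<in> I \<Longrightarrow> random_variable (M' i) (Z i)"
  shows "indep_vars M' Z I"
proof (cases "I = {}")
  case True then show ?thesis by (simp add: indep_vars_def indep_sets_def)
next
  case False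
  have rv: "\<And>i. i \<in> I \<Longrightarrow> random_variable (M' i) (X i)" using X by (simp add: indep_vars_def)
  have "distr M (PiM I M') (\<lambda>\<omega>. \<lambda>i\<in>I. Z i \<omega>) = distr M (PiM I M') (\<lambda>\<omega>. \<lambda>i\<in>I. X i \<omega>)"
  proof (rule distr_cong_AE)
    have "AE \<omega> in M. \<forall>i\<in>I. X i \<omega> = Z i \<omega>" using eq I by (simp add: AE_ball_countable)
    then show "AE \<omega> in M. (\<lambda>i\<in>I. Z i \<omega>) = (\<lambda>i\<in>I. X i \<omega>)" by (rule eventually_mono) auto
  qed (auto intro!: measurable_restrict rv Z)
  also have "\<dots> = PiM I (\<lambda>i. distr M (M' i) (X i))"
    using X indep_vars_iff_distr_eq_PiM'[OF False rv] by simp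
  also have "\<dots> = PiM I (\<lambda>i. distr M (M' i) (Z i))"
    by (intro PiM_cong refl distr_cong_AE eq rv Z)
  finally show ?thesis using indep_vars_iff_distr_eq_PiM'[OF False Z] by simp
qed

context levy_process
begin

text \<open>
  On the null set where the path is irregular or does not start at \<open>0\<close>, and at times \<open>s \<le> 0\<close>, the
  version is set to \<open>0\<close>.
\<close>
lemma right_continuous_version:
  obtains Y where "right_continuous_levy M Y" and "AE \<omega> in M. \<forall>s\<ge>0. Y s \<omega> = \<xi> s \<omega>"
proof -
  have "AE \<omega> in M. \<xi> 0 \<omega> = 0 \<and> (\<forall>s\<ge>0. ((\<lambda>r. \<xi> r \<omega>) \<longlongrightarrow> \<xi> s \<omega>) (at_right s))"
    using start cadlag by eventually_elim simp
  then obtain N where N: "{\<omega>\<in>space M. \<not> (\<xi> 0 \<omega> = 0 \<and> (\<forall>s\<ge>0. ((\<lambda>r. \<xi> r \<omega>) \<longlongrightarrow> \<xi> s \<omega>) (at_right s)))} \<subseteq> N"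
    and N0: "emeasure M N = 0" and N_sets[measurable]: "N \<in> sets M"
    by (rule AE_E)
  define Y where "Y s \<omega> = (if \<omega> \<in> N \<or> s \<le> 0 then 0 else \<xi> s \<omega>)" for s \<omega>
  have ae_N: "AE \<omega> in M. \<omega> \<notin> N" using N0 by (intro AE_not_in) (simp add: null_setsI)
  have eq: "AE \<omega> in M. \<forall>s\<ge>0. Y s \<omega> = \<xi> s \<omega>"
    using ae_N AE_space
  proof eventually_elim
    case (elim \<omega>)
    then have "\<xi> 0 \<omega> = 0" using N by auto
    then show ?case using elim by (auto simp: Y_def)
  qed
  have rv[measurable]: "Y s \<in> borel_measurable M" for s
  proof (cases "s \<le> 0")
    case True
    then have "Y s = (\<lambda>_. 0)" by (auto simp: Y_def)
    then show ?thesis by simp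
  next
    case False
    note random_variable[of s, measurable]
    have "Y s = (\<lambda>\<omega>. if \<omega> \<in> N then 0 else \<xi> s \<omega>)" using False by (auto simp: Y_def)
    then show ?thesis using False by simp
  qed
  have eq_inc: "AE \<omega> in M. \<xi> b \<omega> - \<xi> a \<omega> = Y b \<omega> - Y a \<omega>" if "0 \<le> a" "0 \<le> b" for a b
    using eq that by (auto elim!: eventually_mono)
  have "right_continuous_levy M Y"
  proof
    show "Y 0 \<omega> = 0" for \<omega> by (simp add: Y_def)
    show "((\<lambda>r. Y r \<omega>) \<longlongrightarrow> Y s \<omega>) (at_right s)" if \<omega>: "\<omega> \<in> space M" for \<omega> s
    proof (cases "\<omega> \<in> N")
      case True then show ?thesis by (simp add: Y_def)
    next
      case False
      then have good: "\<xi> 0 \<omega> = 0" "\<And>s. 0 \<le> s \<Longrightarrow> ((\<lambda>r. \<xi> r \<omega>) \<longlongrightarrow> \<xi> s \<omega>) (at_right s)" using N \<omega> by auto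
      show ?thesis
      proof (cases "0 \<le> s")
        case True
        have "\<forall>\<^sub>F r in at_right s. \<xi> r \<omega> = Y r \<omega>"
          using True False by (auto simp: Y_def eventually_at_filter intro!: always_eventually)
        moreover have "Y s \<omega> = \<xi> s \<omega>" using True False good(1) by (auto simp: Y_def)
        ultimately show ?thesis using good(2)[OF True] by (simp add: tendsto_cong)
      next
        case neg: False
        then have "\<forall>\<^sub>F r in at_right s. Y r \<omega> = 0"
          unfolding eventually_at_right_field by (intro exI[of _ 0]) (auto simp: Y_def)
        then have "((\<lambda>r. Y r \<omega>) \<longlongrightarrow> 0) (at_right s)" by (rule tendsto_eventually)
        then show ?thesis using neg by (simp add: Y_def)
      qed
    qed
    show "indep_vars (\<lambda>_. borel) (\<lambda>i \<omega>. Y (t (Suc i)) \<omega> - Y (t i) \<omega>) {..<n}"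
      if "0 \<le> t 0" "\<And>i. t i \<le> t (Suc i)" for t and n :: nat
    proof (rule indep_vars_cong_AE[OF independent_increments])
      have "0 \<le> t i" for i using lift_Suc_mono_le[of t 0 i] that by (auto intro: order_trans)
      then show "AE \<omega> in M. \<xi> (t (Suc i)) \<omega> - \<xi> (t i) \<omega> = Y (t (Suc i)) \<omega> - Y (t i) \<omega>" for i
        by (intro eq_inc)
    qed (use that in auto)
    show "distr M borel (\<lambda>\<omega>. Y (s + h) \<omega> - Y s \<omega>) = distr M borel (Y h)" if "0 \<le> s" "0 \<le> h" for s h
    proof -
      note [measurable] = random_variable
      have "distr M borel (\<lambda>\<omega>. Y (s + h) \<omega> - Y s \<omega>) = distr M borel (\<lambda>\<omega>. \<xi> (s + h) \<omega> - \<xi> s \<omega>)"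
      proof (rule distr_cong_AE)
        show "AE \<omega> in M. Y (s + h) \<omega> - Y s \<omega> = \<xi> (s + h) \<omega> - \<xi> s \<omega>"
          using eq by eventually_elim (use that in simp)
      qed (use that in auto)
      also have "\<dots> = distr M borel (\<lambda>\<omega>. \<xi> h \<omega> - \<xi> 0 \<omega>)" using that by (rule stationary_increments)
      also have "\<dots> = distr M borel (Y h)"
      proof (rule distr_cong_AE)
        show "AE \<omega> in M. \<xi> h \<omega> - \<xi> 0 \<omega> = Y h \<omega>"
          using eq start by eventually_elim (use that in simp)
      qed (use that in auto)
      finally show ?thesis .
    qed
  qed simp
  with eq show ?thesis by (rule that[rotated])
qed

text \<open>
  The potential measure is the image of Lebesgue measure on \<open>{0..}\<close> times \<open>M\<close> under evaluation of
  the path.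
\<close>
lemma potential_integral_eq:
  assumes "right_continuous_levy M Y" and eq: "AE \<omega> in M. \<forall>s\<ge>0. Y s \<omega> = \<xi> s \<omega>"
    and f[measurable]: "f \<in> borel_measurable borel" and E[measurable]: "E \<in> sets borel"
  shows "potential_integral M \<xi> f x E =
    (\<integral>\<^sup>+ s\<in>{0..}. (\<integral>\<^sup>+ \<omega>. ennreal (f (x + Y s \<omega>)) * indicator E (x + Y s \<omega>) \<partial>M) \<partial>lborel)"
proof -
  interpret Y: right_continuous_levy M Y by fact
  let ?T = "density lborel (indicator {0 :: real..})"
  let ?Y = "\<lambda>(s, \<omega>). Y (max 0 s) \<omega>"
  note [measurable] = Y.measurable_Y_joint
  have U: "potential_measure M \<xi> = distr (?T \<Otimes>\<^sub>M M) borel ?Y"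
  proof (rule measure_eqI)
    show "sets (potential_measure M \<xi>) = sets (distr (?T \<Otimes>\<^sub>M M) borel ?Y)"
      using sets.sigma_sets_eq[of "borel :: real measure"] by (simp add: potential_measure_def sets_measure_of_conv)
    fix B assume "B \<in> sets (potential_measure M \<xi>)"
    then have B[measurable]: "B \<in> sets borel"
      using sets.sigma_sets_eq[of "borel :: real measure"] by (simp add: potential_measure_def sets_measure_of_conv)
    have "emeasure (distr (?T \<Otimes>\<^sub>M M) borel ?Y) B = emeasure (?T \<Otimes>\<^sub>M M) (?Y -` B \<inter> space (?T \<Otimes>\<^sub>M M))"
      by (rule emeasure_distr) auto
    also have "\<dots> = (\<integral>\<^sup>+ s. emeasure M (Pair s -` (?Y -` B \<inter> space (?T \<Otimes>\<^sub>M M))) \<partial>?T)"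
      by (rule emeasure_pair_measure_alt) measurable
    also have "\<dots> = (\<integral>\<^sup>+ s. indicator {0..} s * emeasure M (Pair s -` (?Y -` B \<inter> space (?T \<Otimes>\<^sub>M M))) \<partial>lborel)"
    proof (rule nn_integral_density)
      have "(\<lambda>s. emeasure M (Pair s -` (?Y -` B \<inter> space (lborel \<Otimes>\<^sub>M M)))) \<in> borel_measurable lborel"
        by (rule measurable_emeasure_Pair) measurable
      then show "(\<lambda>s. emeasure M (Pair s -` (?Y -` B \<inter> space (?T \<Otimes>\<^sub>M M)))) \<in> borel_measurable lborel"
        by (simp add: space_pair_measure)
    qed simp
    also have "\<dots> = (\<integral>\<^sup>+ s\<in>{0..}. emeasure M {\<omega> \<in> space M. \<xi> s \<omega> \<in> B} \<partial>lborel)"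
    proof (rule nn_integral_cong)
      fix s :: real
      have "emeasure M (Pair s -` (?Y -` B \<inter> space (?T \<Otimes>\<^sub>M M))) = emeasure M {\<omega> \<in> space M. \<xi> s \<omega> \<in> B}" if "0 \<le> s"
      proof -
        note random_variable[OF that, measurable]
        have "Pair s -` (?Y -` B \<inter> space (?T \<Otimes>\<^sub>M M)) = {\<omega> \<in> space M. Y s \<omega> \<in> B}"
          using that by (auto simp: space_pair_measure)
        also have "emeasure M \<dots> = emeasure M {\<omega> \<in> space M. \<xi> s \<omega> \<in> B}"
          using eq that by (intro emeasure_eq_AE) (auto elim!: eventually_mono)
        finally show ?thesis .
      qed
      then show "indicator {0..} s * emeasure M (Pair s -` (?Y -` B \<inter> space (?T \<Otimes>\<^sub>M M))) =
          emeasure M {\<omega> \<in> space M. \<xi> s \<omega> \<in> B} * indicator {0..} s"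
        by (simp add: indicator_def)
    qed
    also have "\<dots> = emeasure (potential_measure M \<xi>) B" by (rule emeasure_potential_measure[OF B, symmetric])
    finally show "emeasure (potential_measure M \<xi>) B = emeasure (distr (?T \<Otimes>\<^sub>M M) borel ?Y) B" by simp
  qed
  have "potential_integral M \<xi> f x E = (\<integral>\<^sup>+ y. ennreal (f (x + y)) * indicator E (x + y) \<partial>distr (?T \<Otimes>\<^sub>M M) borel ?Y)"
    unfolding potential_integral_def U by (intro nn_integral_cong) (simp add: indicator_def)
  also have "\<dots> = (\<integral>\<^sup>+ z. ennreal (f (x + ?Y z)) * indicator E (x + ?Y z) \<partial>(?T \<Otimes>\<^sub>M M))"
    by (rule nn_integral_distr) auto
  also have "\<dots> = (\<integral>\<^sup>+ s. (\<integral>\<^sup>+ \<omega>. ennreal (f (x + Y (max 0 s) \<omega>)) * indicator E (x + Y (max 0 s) \<omega>) \<partial>M) \<partial>?T)"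
    by (subst nn_integral_fst[symmetric]) auto
  also have "\<dots> = (\<integral>\<^sup>+ s. indicator {0..} s * (\<integral>\<^sup>+ \<omega>. ennreal (f (x + Y (max 0 s) \<omega>)) * indicator E (x + Y (max 0 s) \<omega>) \<partial>M) \<partial>lborel)"
    by (rule nn_integral_density) auto
  also have "\<dots> = (\<integral>\<^sup>+ s\<in>{0..}. (\<integral>\<^sup>+ \<omega>. ennreal (f (x + Y s \<omega>)) * indicator E (x + Y s \<omega>) \<partial>M) \<partial>lborel)"
    by (intro nn_integral_cong) (simp add: indicator_def)
  finally show ?thesis .
qed

definition finite_on_bounded_times :: "(real \<Rightarrow> real) \<Rightarrow> bool" where
  "finite_on_bounded_times f \<longleftrightarrow>
    (\<forall>x. AE \<omega> in M. \<forall>t>0. (\<integral>\<^sup>+ s\<in>{0..t}. ennreal (f (x + \<xi> s \<omega>)) \<partial>lborel) < \<infinity>)"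

lemma locally_finite_version:
  assumes "right_continuous_levy M Y" and eq: "AE \<omega> in M. \<forall>s\<ge>0. Y s \<omega> = \<xi> s \<omega>"
    and fin: "finite_on_bounded_times f"
  shows "right_continuous_levy.locally_finite M Y (\<lambda>y. ennreal (f y))"
proof -
  interpret Y: right_continuous_levy M Y by fact
  show ?thesis
    unfolding Y.locally_finite_def
  proof
    fix x
    have "AE \<omega> in M. \<forall>t>0. (\<integral>\<^sup>+ s\<in>{0..t}. ennreal (f (x + \<xi> s \<omega>)) \<partial>lborel) < \<infinity>"
      using fin by (simp add: finite_on_bounded_times_def)
    then show "AE \<omega> in M. \<forall>t>0. (\<integral>\<^sup>+ s\<in>{0..t}. ennreal (f (x + Y s \<omega>)) \<partial>lborel) < \<infinity>"
      using eq
    proof eventually_elim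
      case (elim \<omega>)
      have "(\<integral>\<^sup>+ s\<in>{0..t}. ennreal (f (x + Y s \<omega>)) \<partial>lborel) = (\<integral>\<^sup>+ s\<in>{0..t}. ennreal (f (x + \<xi> s \<omega>)) \<partial>lborel)" for t
        using elim(2) by (intro nn_integral_cong) (simp add: indicator_def)
      then show ?case using elim(1) by simp
    qed
  qed
qed

theorem integral_test_if_lsc:
  assumes Y: "right_continuous_levy M Y" and eq: "AE \<omega> in M. \<forall>s\<ge>0. Y s \<omega> = \<xi> s \<omega>"
    and f[measurable]: "f \<in> borel_measurable borel" and fin: "finite_on_bounded_times f"
    and lsc: "seq_lsc (right_continuous_levy.perpetual_prob M Y (\<lambda>y. ennreal (f y)) {1<..})"
  shows "integral_test M \<xi> f"
proof -
  interpret Y: right_continuous_levy M Y by (rule Y)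
  let ?g = "\<lambda>y. ennreal (f y)"
  have g: "?g \<in> borel_measurable borel" by measurable
  note loc = locally_finite_version[OF Y eq fin]
  have perp: "AE \<omega> in M. perpetual_integral \<xi> f x \<omega> = Y.tail_integral ?g x 0 \<omega>" for x
    using eq
  proof (rule eventually_mono)
    fix \<omega> assume "\<forall>s\<ge>0. Y s \<omega> = \<xi> s \<omega>"
    then show "perpetual_integral \<xi> f x \<omega> = Y.tail_integral ?g x 0 \<omega>"
      unfolding perpetual_integral_def Y.tail_integral_def by (intro nn_integral_cong) (simp add: indicator_def)
  qed
  have trans: "transient_from M \<xi> x (UNIV - E) \<longleftrightarrow> (AE \<omega> in M. \<exists>\<tau>\<ge>0. \<forall>s\<ge>\<tau>. x + Y s \<omega> \<in> E)" for x E
  proof -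
    have *: "(\<exists>\<tau>\<ge>0. \<forall>s\<ge>\<tau>. x + \<xi> s \<omega> \<in> E) \<longleftrightarrow> (\<exists>\<tau>\<ge>0. \<forall>s\<ge>\<tau>. x + Y s \<omega> \<in> E)"
      if "\<forall>s\<ge>0. Y s \<omega> = \<xi> s \<omega>" for \<omega>
      using that by (metis order_trans)
    have "AE \<omega> in M. (\<exists>\<tau>\<ge>0. \<forall>s\<ge>\<tau>. x + \<xi> s \<omega> \<in> E) \<longleftrightarrow> (\<exists>\<tau>\<ge>0. \<forall>s\<ge>\<tau>. x + Y s \<omega> \<in> E)"
      using eq by (rule eventually_mono) (rule *)
    then show ?thesis
      unfolding transient_from_def by (auto intro: eventually_rev_mp elim: eventually_mono)
  qed
  note pot = potential_integral_eq[OF Y eq f]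
  have finite: "AE \<omega> in M. perpetual_integral \<xi> f x \<omega> < \<infinity>"
    if "E \<in> sets borel" "transient_from M \<xi> x (UNIV - E)" "potential_integral M \<xi> f x E < \<infinity>" for x E
  proof -
    have "AE \<omega> in M. Y.tail_integral ?g x 0 \<omega> < \<infinity>"
      using that by (intro Y.potential_finite_imp_AE_finite[OF g loc, of E]) (simp_all add: trans pot)
    then show ?thesis using perp[of x] by eventually_elim simp
  qed
  have converse: "\<exists>E\<in>sets borel. transient_from M \<xi> x (UNIV - E) \<and> potential_integral M \<xi> f x E < \<infinity>"
    if "\<not> (AE \<omega> in M. \<not> perpetual_integral \<xi> f x \<omega> < \<infinity>)" for x
  proof -
    have "\<not> (AE \<omega> in M. \<not> Y.tail_integral ?g x 0 \<omega> < \<infinity>)"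
    proof
      assume "AE \<omega> in M. \<not> Y.tail_integral ?g x 0 \<omega> < \<infinity>"
      then have "AE \<omega> in M. \<not> perpetual_integral \<xi> f x \<omega> < \<infinity>" using perp[of x] by eventually_elim simp
      then show False using that by simp
    qed
    from Y.not_AE_infinite_imp_potential_finite[OF g loc lsc this] show ?thesis
      by (auto simp: trans pot)
  qed
  have not_both: "\<not> (AE \<omega> in M. \<not> perpetual_integral \<xi> f x \<omega> < \<infinity>)"
    if "AE \<omega> in M. perpetual_integral \<xi> f x \<omega> < \<infinity>" for x
  proof
    assume "AE \<omega> in M. \<not> perpetual_integral \<xi> f x \<omega> < \<infinity>"
    with that have "AE \<omega> in M. False" by eventually_elim simp
    then show False by simp
  qed
  show ?thesis
    unfolding integral_test_def
  proof (intro allI conjI iffI ballI impI)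
    fix x E assume "AE \<omega> in M. \<not> perpetual_integral \<xi> f x \<omega> < \<infinity>" "E \<in> sets borel" "transient_from M \<xi> x (UNIV - E)"
    then have "\<not> potential_integral M \<xi> f x E < \<infinity>" using finite not_both by blast
    then show "potential_integral M \<xi> f x E = \<infinity>" by (simp add: less_top[symmetric])
  next
    fix x assume *: "\<forall>E\<in>sets borel. transient_from M \<xi> x (UNIV - E) \<longrightarrow> potential_integral M \<xi> f x E = \<infinity>"
    show "AE \<omega> in M. \<not> perpetual_integral \<xi> f x \<omega> < \<infinity>"
      using converse[of x] * by fastforce
  qed (use finite in blast)
qed

text \<open>
  The supremum \<open>h\<close> of the step functions is lower semicontinuous and agrees with \<open>f\<close> on \<open>L\<close>, so the
  two have the same perpetual integrals.
\<close>
lemma integral_test_of_increasing_steps: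
  assumes f[measurable]: "f \<in> borel_measurable borel" and fin: "finite_on_bounded_times f"
    and L[measurable]: "L \<in> sets borel" and steps: "increasing_step_limit_on L f"
    and in_L: "\<And>s x. 0 < s \<Longrightarrow> AE \<omega> in M. x + \<xi> s \<omega> \<in> L"
  shows "integral_test M \<xi> f"
proof -
  obtain Y where Y: "right_continuous_levy M Y" and eq: "AE \<omega> in M. \<forall>s\<ge>0. Y s \<omega> = \<xi> s \<omega>"
    by (rule right_continuous_version)
  interpret Y: right_continuous_levy M Y by (rule Y)
  from steps[unfolded increasing_step_limit_on_def] obtain F where
    "\<forall>n\<ge>1. open_step_function (F n)" "\<forall>n\<ge>1. \<forall>y. F n y \<le> F (Suc n) y"
    "\<forall>y\<in>L. (\<lambda>n. F n y) \<longlonglongrightarrow> f y"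
    by blast
  note F = this[rule_format]
  define h where "h y = (SUP n\<in>{1..}. ennreal (F n y))" for y
  have step: "F n \<in> borel_measurable borel \<and> seq_lsc (\<lambda>y. ennreal (F n y))" if n: "1 \<le> n" for n
  proof -
    obtain k :: nat and c \<alpha> \<beta> where "\<forall>j\<in>{1..k}. \<alpha> j < \<beta> j \<and> 0 \<le> c j"
      and F_eq: "F n = (\<lambda>y. \<Sum>j=1..k. c j * indicator {\<alpha> j<..<\<beta> j} y)"
      using F(1)[OF n] unfolding open_step_function_def by blast
    then have c: "0 \<le> c j" if "j \<in> {1..k}" for j using that by blast
    have "ennreal (F n y) = (\<integral>\<^sup>+ j. ennreal (c j) * indicator {\<alpha> j<..<\<beta> j} y \<partial>count_space {1..k})" for y
    proof -
      have "ennreal (F n y) = (\<Sum>j=1..k. ennreal (c j * indicator {\<alpha> j<..<\<beta> j} y))"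
        unfolding F_eq using c by (intro sum_ennreal[symmetric]) auto
      also have "\<dots> = (\<Sum>j=1..k. ennreal (c j) * indicator {\<alpha> j<..<\<beta> j} y)"
        using c by (intro sum.cong) (auto simp: indicator_def)
      finally show ?thesis by (simp add: nn_integral_count_space_finite)
    qed
    moreover have "seq_lsc (\<lambda>y. \<integral>\<^sup>+ j. ennreal (c j) * indicator {\<alpha> j<..<\<beta> j} y \<partial>count_space {1..k})"
    proof (rule seq_lsc_nn_integral)
      show "seq_lsc (\<lambda>y. ennreal (c j) * indicator {\<alpha> j<..<\<beta> j} y)" for j
        by (rule seq_lsc_indicator_open) simp
    qed simp
    moreover have "F n \<in> borel_measurable borel" unfolding F_eq by measurable
    ultimately show ?thesis by (simp only: conj_ac)
  qed
  have F_meas[measurable]: "F n \<in> borel_measurable borel" if "n \<in> {1..}" for n using step[of n] that by simp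
  have h_lsc: "seq_lsc h" unfolding h_def by (rule seq_lsc_SUP) (use step in auto)
  have h_meas: "h \<in> borel_measurable borel"
    unfolding h_def by (rule borel_measurable_SUP) (auto intro: measurable_compose[OF F_meas measurable_ennreal])
  have eq_h: "ennreal (f y) = h y" if "y \<in> L" for y
  proof -
    have "incseq (\<lambda>n. ennreal (F (Suc n) y))"
      using F(2)[of "Suc _" y] by (intro incseq_SucI ennreal_leI) simp
    moreover have "(\<lambda>n. ennreal (F (Suc n) y)) \<longlonglongrightarrow> ennreal (f y)"
      using LIMSEQ_Suc[OF F(3)[OF that]] by (intro tendsto_ennrealI)
    ultimately have "ennreal (f y) = (SUP n. ennreal (F (Suc n) y))"
      using LIMSEQ_SUP LIMSEQ_unique by blast
    also have "\<dots> = h y"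
    proof -
      have "{1..} = range Suc" by (auto simp: image_iff Suc_le_eq gr0_conv_Suc)
      then show ?thesis unfolding h_def by (simp add: image_image)
    qed
    finally show ?thesis .
  qed
  have in_L': "AE \<omega> in M. x + Y s \<omega> \<in> L" if "0 < s" for s x
    using in_L[OF that, of x] eq by eventually_elim (use that in simp)
  have "Y.perpetual_prob (\<lambda>y. ennreal (f y)) {1<..} = Y.perpetual_prob h {1<..}"
    by (rule Y.perpetual_prob_cong[OF _ h_meas L _ in_L' eq_h]) auto
  then show ?thesis
    using integral_test_if_lsc[OF Y eq f fin] Y.seq_lsc_perpetual_prob_of_lsc[OF h_meas h_lsc] by simp
qed

lemma integral_test_of_absolutely_continuous:
  assumes f[measurable]: "f \<in> borel_measurable borel" and fin: "finite_on_bounded_times f"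
    and ac: "\<And>s A. 0 < s \<Longrightarrow> A \<in> null_sets lborel \<Longrightarrow> AE \<omega> in M. \<xi> s \<omega> \<notin> A"
  shows "integral_test M \<xi> f"
proof -
  obtain Y where Y: "right_continuous_levy M Y" and eq: "AE \<omega> in M. \<forall>s\<ge>0. Y s \<omega> = \<xi> s \<omega>"
    by (rule right_continuous_version)
  interpret Y: right_continuous_levy M Y by (rule Y)
  have "AE \<omega> in M. Y s \<omega> \<notin> A" if "0 < s" "A \<in> null_sets lborel" for s A
    using ac[OF that] eq by eventually_elim (use that in simp)
  then show ?thesis
    by (intro integral_test_if_lsc[OF Y eq f fin] Y.seq_lsc_perpetual_prob_of_ac) auto
qed

lemma locally_bounded_imp_finite_on_bounded_times:
  assumes "locally_bounded f"
  shows "finite_on_bounded_times f"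
  unfolding finite_on_bounded_times_def
proof
  fix x
  show "AE \<omega> in M. \<forall>t>0. (\<integral>\<^sup>+ s\<in>{0..t}. ennreal (f (x + \<xi> s \<omega>)) \<partial>lborel) < \<infinity>"
    using cadlag
  proof (eventually_elim, intro allI impI)
    fix \<omega> and t :: real
    assume "(\<forall>s\<ge>0. ((\<lambda>r. \<xi> r \<omega>) \<longlongrightarrow> \<xi> s \<omega>) (at_right s)) \<and> (\<forall>s>0. \<exists>l. ((\<lambda>r. \<xi> r \<omega>) \<longlongrightarrow> l) (at_left s))"
    then have "bounded ((\<lambda>s. \<xi> s \<omega>) ` {0..t})" by (intro cadlag_imp_bounded) auto
    then obtain R where "\<forall>y\<in>(\<lambda>s. \<xi> s \<omega>) ` {0..t}. norm y \<le> R" unfolding bounded_iff by blast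
    then have R: "\<bar>\<xi> s \<omega>\<bar> \<le> R" if "s \<in> {0..t}" for s using that by auto
    have "bounded (f ` cball x R)" using assms by (simp add: locally_bounded_def)
    then obtain C where "\<forall>y\<in>f ` cball x R. norm y \<le> C" unfolding bounded_iff by blast
    then have C: "\<bar>f y\<bar> \<le> C" if "y \<in> cball x R" for y using that by auto
    have "(\<integral>\<^sup>+ s\<in>{0..t}. ennreal (f (x + \<xi> s \<omega>)) \<partial>lborel) \<le> (\<integral>\<^sup>+ s. ennreal C * indicator {0..t} s \<partial>lborel)"
    proof (rule nn_integral_mono)
      fix s :: real
      have "f (x + \<xi> s \<omega>) \<le> C" if "s \<in> {0..t}"
        using C[of "x + \<xi> s \<omega>"] R[OF that] by (simp add: dist_real_def abs_le_iff)
      then show "ennreal (f (x + \<xi> s \<omega>)) * indicator {0..t} s \<le> ennreal C * indicator {0..t} s"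
        by (auto simp: indicator_def intro: ennreal_leI)
    qed
    also have "\<dots> < \<infinity>"
      by (subst nn_integral_cmult_indicator) (auto simp: ennreal_mult_less_top emeasure_lborel_Icc_eq)
    finally show "(\<integral>\<^sup>+ s\<in>{0..t}. ennreal (f (x + \<xi> s \<omega>)) \<partial>lborel) < \<infinity>" .
  qed
qed

end

theorem corollary2p1:
  fixes M :: "'a measure" and \<xi> :: "real \<Rightarrow> 'a \<Rightarrow> real"
  assumes "levy_process M \<xi>"
    and "AE \<omega> in M. filterlim (\<lambda>s. \<xi> s \<omega>) at_top at_top"
  shows
    "(\<forall>f L.
        f \<in> borel_measurable borel \<and> (\<forall>y. 0 \<le> f y) \<and> locally_bounded f \<and>
        L \<in> sets borel \<and> increasing_step_limit_on L f \<and>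
        (\<forall>s>0. \<forall>x. AE \<omega> in M. x + \<xi> s \<omega> \<notin> - L)
        \<longrightarrow> integral_test M \<xi> f)
   \<and> ((\<forall>s>0. \<forall>x. \<forall>A\<in>null_sets lebesgue. AE \<omega> in M. x + \<xi> s \<omega> \<notin> A) \<longrightarrow>
      (\<forall>f.
        f \<in> borel_measurable borel \<and> (\<forall>y. 0 \<le> f y) \<and> locally_bounded f
        \<longrightarrow> integral_test M \<xi> f))
   \<and> (\<forall>f L.
        f \<in> borel_measurable borel \<and> (\<forall>y. 0 \<le> f y) \<and> locally_integrable f \<and>
        (\<forall>x. AE \<omega> in M. \<forall>t>0. (\<integral>\<^sup>+ s\<in>{0..t}. ennreal (f (x + \<xi> s \<omega>)) \<partial>lborel) < \<infinity>) \<and>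
        L \<in> sets borel \<and> increasing_step_limit_on L f \<and>
        (\<forall>s>0. \<forall>x. AE \<omega> in M. x + \<xi> s \<omega> \<notin> - L)
        \<longrightarrow> integral_test M \<xi> f)
   \<and> ((\<forall>s>0. \<forall>x. \<forall>A\<in>null_sets lebesgue. AE \<omega> in M. x + \<xi> s \<omega> \<notin> A) \<longrightarrow>
      (\<forall>f.
        f \<in> borel_measurable borel \<and> (\<forall>y. 0 \<le> f y) \<and> locally_integrable f \<and>
        (\<forall>x. AE \<omega> in M. \<forall>t>0. (\<integral>\<^sup>+ s\<in>{0..t}. ennreal (f (x + \<xi> s \<omega>)) \<partial>lborel) < \<infinity>)
        \<longrightarrow> integral_test M \<xi> f))"
proof -
  interpret levy_process M \<xi> by fact
  have steps: "integral_test M \<xi> f"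
    if "f \<in> borel_measurable borel" "finite_on_bounded_times f" "L \<in> sets borel" "increasing_step_limit_on L f"
      "\<forall>s>0. \<forall>x. AE \<omega> in M. x + \<xi> s \<omega> \<notin> - L" for f L
    using that by (intro integral_test_of_increasing_steps[of f L]) auto
  have ac: "integral_test M \<xi> f"
    if "\<forall>s>0. \<forall>x. \<forall>A\<in>null_sets lebesgue. AE \<omega> in M. x + \<xi> s \<omega> \<notin> A"
      "f \<in> borel_measurable borel" "finite_on_bounded_times f" for f
  proof (rule integral_test_of_absolutely_continuous[OF that(2,3)])
    fix s :: real and A :: "real set" assume "0 < s" "A \<in> null_sets lborel"
    then have "AE \<omega> in M. 0 + \<xi> s \<omega> \<notin> A" using that(1) null_sets_completionI by blast
    then show "AE \<omega> in M. \<xi> s \<omega> \<notin> A" by simp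
  qed
  show ?thesis
    by (intro conjI allI impI; elim conjE)
      (blast intro: steps ac locally_bounded_imp_finite_on_bounded_times finite_on_bounded_times_def[THEN iffD2])+
qed

end
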